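(* Let $\mathfrak{L}$ be the complex Lie algebra with basis $\{L_n,W_n,Z_n \mid n\in\mathbb{Z}\}$ whose non-vanishing Lie brackets of basis elements are given, for $m,n\in\mathbb{Z}$, by $$[L_m,L_n]=(m-n)L_{m+n},\quad [L_m,W_n]=-(m+n)W_{m+n},\quad [L_m,Z_n]=-(3m+n)Z_{m+n},\quad [W_m,W_n]=(m-n)Z_{m+n}$$ (together with those forced by antisymmetry). Then every Lie bialgebra $(\mathfrak{L},[\cdot,\cdot],\Delta)$ is triangular coboundary; that is, for every linear map $\Delta:\mathfrak{L}\to\mathfrak{L}\otimes\mathfrak{L}$ such that $(\mathfrak{L},[\cdot,\cdot],\Delta)$ is a Lie bialgebra, there exists $r\in\mathrm{Im}(1-\tau)\subset\mathfrak{L}\otimes\mathfrak{L}$ such that $\Delta(x)=x\cdot r$ for all $x\in\mathfrak{L}$ and $\mathbf{c}(r)=0$.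
   Context: All vector spaces and tensor products are over $\mathbb{C}$. For a vector space $L$, $\tau:L\otimes L\to L\otimes L$ is the twist map $\tau(x_1\otimes x_2)=x_2\otimes x_1$, and $\xi:L\otimes L\otimes L\to L\otimes L\otimes L$ is the cyclic map $\xi(x_1\otimes x_2\otimes x_3)=x_2\otimes x_3\otimes x_1$. In $\mathrm{Im}(1-\tau)$, $1$ denotes the identity map of $L\otimes L$. For a Lie algebra $L$, the diagonal adjoint action of $x\in L$ on $L\otimes L$ is $x\cdot\sum_i a_i\otimes b_i=\sum_i([x,a_i]\otimes b_i+a_i\otimes[x,b_i])$. A Lie coalgebra is a pair $(L,\Delta)$ with $L$ a vector space and $\Delta:L\to L\otimes L$ a linear map such that $\mathrm{Im}\,\Delta\subset\mathrm{Im}(1-\tau)$ and $(1+\xi+\xi^2)\cdot(1\otimes\Delta)\cdot\Delta=0$ as a map $L\to L\otimes L\otimes L$ (products denote composition). A Lie bialgebra is a triple $(L,[\cdot,\cdot],\Delta)$ such that $(L,[\cdot,\cdot])$ is a Lie algebra, $(L,\Delta)$ is a Lie coalgebra, and $\Delta([x,y])=x\cdot\Delta(y)-y\cdot\Delta(x)$ for all $x,y\in L$. For $r=\sum_i a_i\otimes b_i\in L\otimes L$, the element $\mathbf{c}(r)$ is $$\mathbf{c}(r)=\sum_{i,j}[a_i,a_j]\otimes b_i\otimes b_j+\sum_{i,j}a_i\otimes[b_i,a_j]\otimes b_j+\sum_{i,j}a_i\otimes a_j\otimes[b_i,b_j]\in L\otimes L\otimes L.$$ A coboundary Lie bialgebra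 is a 4-tuple $(L,[\cdot,\cdot],\Delta,r)$ where $(L,[\cdot,\cdot],\Delta)$ is a Lie bialgebra and $r\in\mathrm{Im}(1-\tau)\subset L\otimes L$ satisfies $\Delta(x)=x\cdot r$ for all $x\in L$. It is called triangular if $r$ satisfies the classical Yang–Baxter equation $\mathbf{c}(r)=0$. *)

theory Defs
  imports Complex_Main "HOL-Library.Poly_Mapping"
begin

section \<open>Complex vector spaces with a basis and their tensor products\<close>

text \<open>
  The type \<open>'b cvec\<close> is the complex vector space with basis (indexed by) \<open>'b\<close>, i.e. the space of
  finitely supported functions from \<open>'b\<close> to the complex numbers.  Since the tensor product of the
  spaces with bases \<open>'a\<close> and \<open>'b\<close> is free on the products of basis vectors, it is modelled by
  \<open>('a \<times> 'b) cvec\<close>; the universal property is proved as \<open>tensor_universal\<close> below.  The triple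
  tensor product is \<open>('a \<times> 'b \<times> 'c) cvec\<close>.
\<close>

type_synonym 'b cvec = "'b \<Rightarrow>\<^sub>0 complex"

definition cscale :: "complex \<Rightarrow> 'b cvec \<Rightarrow> 'b cvec" where
  "cscale c = Poly_Mapping.map ((*) c)"

abbreviation basis :: "'b \<Rightarrow> 'b cvec" where
  "basis k \<equiv> Poly_Mapping.single k 1"

abbreviation clinear :: "('a cvec \<Rightarrow> 'b cvec) \<Rightarrow> bool" where
  "clinear \<equiv> Vector_Spaces.linear cscale cscale"

definition lin_ext_to :: "(complex \<Rightarrow> 'd \<Rightarrow> 'd) \<Rightarrow> ('a \<Rightarrow> 'd::ab_group_add) \<Rightarrow> 'a cvec \<Rightarrow> 'd" where
  "lin_ext_to s f p = (\<Sum>k\<in>Poly_Mapping.keys p. s (Poly_Mapping.lookup p k) (f k))"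

abbreviation lin_ext :: "('a \<Rightarrow> 'b cvec) \<Rightarrow> 'a cvec \<Rightarrow> 'b cvec" where
  "lin_ext \<equiv> lin_ext_to cscale"

definition bilin_ext :: "('a \<Rightarrow> 'b \<Rightarrow> 'c cvec) \<Rightarrow> 'a cvec \<Rightarrow> 'b cvec \<Rightarrow> 'c cvec" where
  "bilin_ext f x y = lin_ext (\<lambda>i. lin_ext (f i) y) x"

definition tensor :: "'a cvec \<Rightarrow> 'b cvec \<Rightarrow> ('a \<times> 'b) cvec" (infixr \<open>\<otimes>\<close> 75) where
  "x \<otimes> y = bilin_ext (\<lambda>i j. basis (i, j)) x y"

definition tensor_map :: "('a cvec \<Rightarrow> 'c cvec) \<Rightarrow> ('b cvec \<Rightarrow> 'd cvec)
    \<Rightarrow> ('a \<times> 'b) cvec \<Rightarrow> ('c \<times> 'd) cvec" where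
  "tensor_map f g = lin_ext (\<lambda>(i, j). f (basis i) \<otimes> g (basis j))"

definition twist :: "('b \<times> 'b) cvec \<Rightarrow> ('b \<times> 'b) cvec" where
  "twist = lin_ext (\<lambda>(i, j). basis (j, i))"

definition cyc :: "('b \<times> 'b \<times> 'b) cvec \<Rightarrow> ('b \<times> 'b \<times> 'b) cvec" where
  "cyc = lin_ext (\<lambda>(i, j, k). basis (j, k, i))"

definition skew_tensors :: "('b \<times> 'b) cvec set" where
  "skew_tensors = range (\<lambda>t. t - twist t)"


section \<open>Lie algebras, Lie coalgebras and Lie bialgebras\<close>

definition lie_algebra :: "('b cvec \<Rightarrow> 'b cvec \<Rightarrow> 'b cvec) \<Rightarrow> bool" where
  "lie_algebra br \<longleftrightarrow>
     (\<forall>x. clinear (br x)) \<and> (\<forall>y. clinear (\<lambda>x. br x y)) \<and>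
     (\<forall>x. br x x = 0) \<and>
     (\<forall>x y z. br x (br y z) + br y (br z x) + br z (br x y) = 0)"

definition adj_act :: "('b cvec \<Rightarrow> 'b cvec \<Rightarrow> 'b cvec) \<Rightarrow> 'b cvec
    \<Rightarrow> ('b \<times> 'b) cvec \<Rightarrow> ('b \<times> 'b) cvec" where
  "adj_act br x t = tensor_map (br x) id t + tensor_map id (br x) t"

definition lie_coalgebra :: "('b cvec \<Rightarrow> ('b \<times> 'b) cvec) \<Rightarrow> bool" where
  "lie_coalgebra \<Delta> \<longleftrightarrow>
     clinear \<Delta> \<and> range \<Delta> \<subseteq> skew_tensors \<and>
     (\<forall>x. let t = tensor_map id \<Delta> (\<Delta> x) in t + cyc t + cyc (cyc t) = 0)"

definition lie_bialgebra :: "('b cvec \<Rightarrow> 'b cvec \<Rightarrow> 'b cvec)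
    \<Rightarrow> ('b cvec \<Rightarrow> ('b \<times> 'b) cvec) \<Rightarrow> bool" where
  "lie_bialgebra br \<Delta> \<longleftrightarrow>
     lie_algebra br \<and> lie_coalgebra \<Delta> \<and>
     (\<forall>x y. \<Delta> (br x y) = adj_act br x (\<Delta> y) - adj_act br y (\<Delta> x))"

text \<open>
  The element \<open>c(r)\<close> is given here through the expansion of \<open>r\<close> in the basis of the tensor square;
  lemma \<open>cyb_sum\<close> below shows that the defining formula holds for every representation of \<open>r\<close> as a
  finite sum of pure tensors.
\<close>

definition cyb :: "('b cvec \<Rightarrow> 'b cvec \<Rightarrow> 'b cvec) \<Rightarrow> ('b \<times> 'b) cvec
    \<Rightarrow> ('b \<times> 'b \<times> 'b) cvec" where
  "cyb br r = bilin_ext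
     (\<lambda>(a, b) (a', b').
        br (basis a) (basis a') \<otimes> basis b \<otimes> basis b'
      + basis a \<otimes> br (basis b) (basis a') \<otimes> basis b'
      + basis a \<otimes> basis a' \<otimes> br (basis b) (basis b')) r r"

definition coboundary_lie_bialgebra :: "('b cvec \<Rightarrow> 'b cvec \<Rightarrow> 'b cvec)
    \<Rightarrow> ('b cvec \<Rightarrow> ('b \<times> 'b) cvec) \<Rightarrow> ('b \<times> 'b) cvec \<Rightarrow> bool" where
  "coboundary_lie_bialgebra br \<Delta> r \<longleftrightarrow>
     lie_bialgebra br \<Delta> \<and> r \<in> skew_tensors \<and> (\<forall>x. \<Delta> x = adj_act br x r)"

definition triangular_coboundary_lie_bialgebra :: "('b cvec \<Rightarrow> 'b cvec \<Rightarrow> 'b cvec)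
    \<Rightarrow> ('b cvec \<Rightarrow> ('b \<times> 'b) cvec) \<Rightarrow> ('b \<times> 'b) cvec \<Rightarrow> bool" where
  "triangular_coboundary_lie_bialgebra br \<Delta> r \<longleftrightarrow>
     coboundary_lie_bialgebra br \<Delta> r \<and> cyb br r = 0"


section \<open>The Lie algebra with basis \<open>L n\<close>, \<open>W n\<close>, \<open>Z n\<close>\<close>

datatype gen = L int | W int | Z int

fun gen_bracket :: "gen \<Rightarrow> gen \<Rightarrow> gen cvec" where
  "gen_bracket (L m) (L n) = cscale (of_int (m - n)) (basis (L (m + n)))"
| "gen_bracket (L m) (W n) = cscale (of_int (- (m + n))) (basis (W (m + n)))"
| "gen_bracket (W n) (L m) = cscale (of_int (m + n)) (basis (W (m + n)))"
| "gen_bracket (L m) (Z n) = cscale (of_int (- (3 * m + n))) (basis (Z (m + n)))"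
| "gen_bracket (Z n) (L m) = cscale (of_int (3 * m + n)) (basis (Z (m + n)))"
| "gen_bracket (W m) (W n) = cscale (of_int (m - n)) (basis (Z (m + n)))"
| "gen_bracket (W m) (Z n) = 0"
| "gen_bracket (Z m) (W n) = 0"
| "gen_bracket (Z m) (Z n) = 0"

definition bracket :: "gen cvec \<Rightarrow> gen cvec \<Rightarrow> gen cvec" where
  "bracket = bilin_ext gen_bracket"


section \<open>Basic properties of these notions\<close>

lemma lookup_cscale [simp]: "Poly_Mapping.lookup (cscale c p) k = c * Poly_Mapping.lookup p k"
  by (simp add: cscale_def Poly_Mapping.map.rep_eq when_def)

lemma vector_space_cscale: "vector_space (cscale :: complex \<Rightarrow> 'b cvec \<Rightarrow> 'b cvec)"
  by unfold_locales (auto intro!: poly_mapping_eqI simp: lookup_add algebra_simps)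

interpretation cvec: vector_space "cscale :: complex \<Rightarrow> 'b cvec \<Rightarrow> 'b cvec"
  by (rule vector_space_cscale)

lemma basis_expansion:
  "p = (\<Sum>k\<in>Poly_Mapping.keys p. cscale (Poly_Mapping.lookup p k) (basis k))"
  by (rule poly_mapping_eqI)
    (simp add: lookup_sum lookup_single when_def in_keys_iff if_distrib sum.delta cong: if_cong)

lemma linear_sum_scale:
  assumes "Vector_Spaces.linear s1 s2 f"
  shows "f (\<Sum>i\<in>I. s1 (c i) (v i)) = (\<Sum>i\<in>I. s2 (c i) (f (v i)))"
proof -
  interpret Vector_Spaces.linear s1 s2 f by fact
  show ?thesis by (simp add: sum scale)
qed

lemma linear_eq_on_basis:
  assumes f: "Vector_Spaces.linear cscale s f" and g: "Vector_Spaces.linear cscale s g"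
    and eq: "\<And>k. f (basis k) = g (basis k)"
  shows "f p = g p"
proof -
  have "f (\<Sum>k\<in>Poly_Mapping.keys p. cscale (Poly_Mapping.lookup p k) (basis k))
      = g (\<Sum>k\<in>Poly_Mapping.keys p. cscale (Poly_Mapping.lookup p k) (basis k))"
    by (simp only: linear_sum_scale[OF f] linear_sum_scale[OF g] eq)
  then show ?thesis by (simp only: basis_expansion[symmetric])
qed

lemma lin_ext_to_basis [simp]:
  assumes "vector_space s" shows "lin_ext_to s f (basis k) = f k"
  using assms by (simp add: lin_ext_to_def vector_space_def)

lemma linear_lin_ext_to:
  assumes "vector_space s" shows "Vector_Spaces.linear cscale s (lin_ext_to s f)"
proof -
  interpret s: vector_space s by fact
  have sup: "lin_ext_to s f p = (\<Sum>k\<in>K. s (Poly_Mapping.lookup p k) (f k))"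
    if "finite K" "Poly_Mapping.keys p \<subseteq> K" for p K
    unfolding lin_ext_to_def using that
    by (intro sum.mono_neutral_left) (auto simp: in_keys_iff)
  show ?thesis
  proof (unfold_locales, goal_cases)
    case (1 p q)
    have "lin_ext_to s f (p + q) = (\<Sum>k\<in>Poly_Mapping.keys p \<union> Poly_Mapping.keys q.
        s (Poly_Mapping.lookup (p + q) k) (f k))"
      by (rule sup) (auto dest: keys_add[THEN subsetD])
    moreover have "lin_ext_to s f p = (\<Sum>k\<in>Poly_Mapping.keys p \<union> Poly_Mapping.keys q.
        s (Poly_Mapping.lookup p k) (f k))" by (rule sup) auto
    moreover have "lin_ext_to s f q = (\<Sum>k\<in>Poly_Mapping.keys p \<union> Poly_Mapping.keys q.
        s (Poly_Mapping.lookup q k) (f k))" by (rule sup) auto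
    ultimately show ?case by (simp add: lookup_add s.scale_left_distrib sum.distrib)
  next
    case (2 c p)
    have "lin_ext_to s f (cscale c p) =
        (\<Sum>k\<in>Poly_Mapping.keys p. s (Poly_Mapping.lookup (cscale c p) k) (f k))"
      by (rule sup) (auto simp: in_keys_iff)
    then show ?case by (simp add: lin_ext_to_def s.scale_sum_right)
  qed
qed

lemmas clinear_lin_ext = linear_lin_ext_to[OF vector_space_cscale]
lemmas lin_ext_basis [simp] = lin_ext_to_basis[OF vector_space_cscale]

lemma clinearI:
  assumes "\<And>x y. f (x + y) = f x + f y" "\<And>c x. f (cscale c x) = cscale c (f x)"
  shows "clinear f"
  by unfold_locales (use assms in auto)

lemma clinear_add: "clinear f \<Longrightarrow> f (x + y) = f x + f y"
  and clinear_scale: "clinear f \<Longrightarrow> f (cscale c x) = cscale c (f x)"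
  and clinear_zero: "clinear f \<Longrightarrow> f 0 = 0"
  and clinear_neg: "clinear f \<Longrightarrow> f (- x) = - f x"
  by (simp_all add: module_hom_iff_linear[symmetric] module_hom.add module_hom.scale
      module_hom.zero module_hom.neg)

lemma clinear_sum: "clinear f \<Longrightarrow> f (\<Sum>i\<in>I. v i) = (\<Sum>i\<in>I. f (v i))"
  by (simp add: module_hom_iff_linear[symmetric] module_hom.sum)

lemma clinear_plus: "clinear f \<Longrightarrow> clinear g \<Longrightarrow> clinear (\<lambda>x. f x + g x)"
  by (rule clinearI) (simp_all add: clinear_add clinear_scale algebra_simps cvec.scale_right_distrib)

lemma clinear_uminus: "clinear f \<Longrightarrow> clinear (\<lambda>x. - f x)"
  by (rule clinearI) (simp_all add: clinear_add clinear_scale)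

lemma clinear_comp: "clinear f \<Longrightarrow> clinear g \<Longrightarrow> clinear (\<lambda>x. f (g x))"
  by (rule clinearI) (simp_all add: clinear_add clinear_scale)

lemma clinear_zero_map: "clinear (\<lambda>x. 0)"
  by (rule clinearI) simp_all

lemma clinear_id: "clinear (\<lambda>x. x)" "clinear id"
  by (rule clinearI; simp)+

lemma bilin_ext_basis [simp]: "bilin_ext f (basis i) (basis j) = f i j"
  by (simp add: bilin_ext_def)

lemma clinear_bilin_ext_left: "clinear (\<lambda>x. bilin_ext f x y)"
  unfolding bilin_ext_def by (rule clinear_lin_ext)

lemma clinear_bilin_ext_right: "clinear (bilin_ext f x)"
  by (rule clinearI)
    (simp_all add: bilin_ext_def lin_ext_to_def[of _ _ x] clinear_add[OF clinear_lin_ext]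
      clinear_scale[OF clinear_lin_ext] cvec.scale_right_distrib sum.distrib cvec.scale_sum_right
      mult.commute)

lemma tensor_basis [simp]: "basis i \<otimes> basis j = basis (i, j)"
  by (simp add: tensor_def)

lemma clinear_tensor_left: "clinear (\<lambda>x. x \<otimes> y)"
  and clinear_tensor_right: "clinear (\<lambda>y. x \<otimes> y)"
  by (simp_all add: tensor_def clinear_bilin_ext_left clinear_bilin_ext_right)

lemma bilinear_eq_on_basis:
  assumes f1: "\<And>y. Vector_Spaces.linear cscale s (\<lambda>x. f x y)"
    and f2: "\<And>x. Vector_Spaces.linear cscale s (\<lambda>y. f x y)"
    and g1: "\<And>y. Vector_Spaces.linear cscale s (\<lambda>x. g x y)"
    and g2: "\<And>x. Vector_Spaces.linear cscale s (\<lambda>y. g x y)"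
    and eq: "\<And>i j. f (basis i) (basis j) = g (basis i) (basis j)"
  shows "f x y = g x y"
proof (rule linear_eq_on_basis[OF f1 g1])
  fix i show "f (basis i) y = g (basis i) y"
    by (rule linear_eq_on_basis[OF f2 g2]) (rule eq)
qed

theorem tensor_universal:
  fixes s :: "complex \<Rightarrow> 'd \<Rightarrow> 'd::ab_group_add" and f :: "'a cvec \<Rightarrow> 'b cvec \<Rightarrow> 'd"
  assumes f1: "\<And>y. Vector_Spaces.linear cscale s (\<lambda>x. f x y)"
    and f2: "\<And>x. Vector_Spaces.linear cscale s (\<lambda>y. f x y)"
  shows "\<exists>!g. Vector_Spaces.linear cscale s g \<and> (\<forall>x y. g (x \<otimes> y) = f x y)"
proof (rule ex1I)
  have vs: "vector_space s" using f1[of 0] by (simp add: Vector_Spaces.linear_def)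
  let ?g = "lin_ext_to s (\<lambda>(i, j). f (basis i) (basis j))"
  have g: "Vector_Spaces.linear cscale s ?g" by (rule linear_lin_ext_to[OF vs])
  have "?g (x \<otimes> y) = f x y" for x y
    by (rule bilinear_eq_on_basis[where s = s and f = "\<lambda>x y. ?g (x \<otimes> y)"])
      (auto intro: f1 f2 Vector_Spaces.linear_compose[OF clinear_tensor_left g, unfolded o_def]
        Vector_Spaces.linear_compose[OF clinear_tensor_right g, unfolded o_def]
        simp: lin_ext_to_basis[OF vs])
  with g show "Vector_Spaces.linear cscale s ?g \<and> (\<forall>x y. ?g (x \<otimes> y) = f x y)" by blast
  fix h assume h: "Vector_Spaces.linear cscale s h \<and> (\<forall>x y. h (x \<otimes> y) = f x y)"
  show "h = ?g"
  proof
    fix t show "h t = ?g t"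
    proof (rule linear_eq_on_basis[of s])
      fix k :: "'a \<times> 'b"
      obtain i j where k: "k = (i, j)" by (cases k)
      have "h (basis i \<otimes> basis j) = f (basis i) (basis j)" using h by blast
      then show "h (basis k) = ?g (basis k)" by (simp add: lin_ext_to_basis[OF vs] k)
    qed (use h g in blast)+
  qed
qed

lemma clinear_twist: "clinear twist"
  by (simp add: twist_def clinear_lin_ext)

lemma clinear_cyc: "clinear cyc"
  by (simp add: cyc_def clinear_lin_ext)

lemma clinear_tensor_map: "clinear (tensor_map f g)"
  by (simp add: tensor_map_def clinear_lin_ext)

lemma twist_basis [simp]: "twist (basis (i, j)) = basis (j, i)"
  by (simp add: twist_def)

lemma tensor_map_basis [simp]: "tensor_map f g (basis (i, j)) = f (basis i) \<otimes> g (basis j)"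
  by (simp add: tensor_map_def)

lemma twist_tensor: "twist (x \<otimes> y) = y \<otimes> x"
  by (rule bilinear_eq_on_basis[where s = cscale and f = "\<lambda>x y. twist (x \<otimes> y)"
        and g = "\<lambda>x y. y \<otimes> x"])
    (auto intro: clinear_comp[OF clinear_twist] clinear_tensor_left clinear_tensor_right)

lemma tensor_map_tensor:
  assumes "clinear f" "clinear g"
  shows "tensor_map f g (x \<otimes> y) = f x \<otimes> g y"
  by (rule bilinear_eq_on_basis[where s = cscale and f = "\<lambda>x y. tensor_map f g (x \<otimes> y)"
        and g = "\<lambda>x y. f x \<otimes> g y"])
    (auto intro: clinear_comp[OF clinear_tensor_map] clinear_tensor_left clinear_tensor_right
      clinear_comp[OF clinear_tensor_left assms(1)] clinear_comp[OF clinear_tensor_right assms(2)])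

lemma cyc_tensor: "cyc (x \<otimes> y \<otimes> z) = y \<otimes> z \<otimes> x"
proof (rule bilinear_eq_on_basis[where s = cscale and f = "\<lambda>x y. cyc (x \<otimes> y \<otimes> z)"
      and g = "\<lambda>x y. y \<otimes> z \<otimes> x"])
  fix i j
  show "cyc (basis i \<otimes> basis j \<otimes> z) = basis j \<otimes> z \<otimes> basis i"
    by (rule linear_eq_on_basis[where s = cscale and f = "\<lambda>z. cyc (basis i \<otimes> basis j \<otimes> z)"
          and g = "\<lambda>z. basis j \<otimes> z \<otimes> basis i"])
      (auto intro!: clinear_comp[OF clinear_cyc] clinear_comp[OF clinear_tensor_right]
        clinear_tensor_left clinear_tensor_right, simp add: cyc_def)
qed (auto intro!: clinear_comp[OF clinear_cyc] clinear_comp[OF clinear_tensor_right]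
    clinear_tensor_left clinear_tensor_right)

lemma adj_act_tensor:
  assumes "lie_algebra br"
  shows "adj_act br x (a \<otimes> b) = br x a \<otimes> b + a \<otimes> br x b"
  using assms by (simp add: adj_act_def lie_algebra_def tensor_map_tensor clinear_id)

lemma cyb_sum:
  assumes br: "lie_algebra br" and r: "r = (\<Sum>i\<in>I. a i \<otimes> b i)"
  shows "cyb br r =
      (\<Sum>i\<in>I. \<Sum>j\<in>I. br (a i) (a j) \<otimes> b i \<otimes> b j)
    + (\<Sum>i\<in>I. \<Sum>j\<in>I. a i \<otimes> br (b i) (a j) \<otimes> b j)
    + (\<Sum>i\<in>I. \<Sum>j\<in>I. a i \<otimes> a j \<otimes> br (b i) (b j))"
proof -
  define B where "B = bilin_ext (\<lambda>(a, b) (a', b').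
        br (basis a) (basis a') \<otimes> basis b \<otimes> basis b'
      + basis a \<otimes> br (basis b) (basis a') \<otimes> basis b'
      + basis a \<otimes> basis a' \<otimes> br (basis b) (basis b'))"
  define C where "C = (\<lambda>a b a' b'. br a a' \<otimes> b \<otimes> b' + a \<otimes> br b a' \<otimes> b' + a \<otimes> a' \<otimes> br b b')"
  have br1: "clinear (br x)" and br2: "clinear (\<lambda>x. br x y)" for x y
    using br by (auto simp: lie_algebra_def)
  note lins = br1 br2 clinear_plus clinear_tensor_left clinear_tensor_right
    clinear_comp[OF clinear_tensor_right clinear_tensor_left]
    clinear_comp[OF clinear_tensor_right clinear_tensor_right]
    clinear_comp[OF clinear_tensor_left br1] clinear_comp[OF clinear_tensor_left br2]
    clinear_comp[OF clinear_tensor_right br1] clinear_comp[OF clinear_tensor_right br2]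
    clinear_comp[OF clinear_tensor_right clinear_comp[OF clinear_tensor_left br1]]
    clinear_comp[OF clinear_tensor_right clinear_comp[OF clinear_tensor_left br2]]
    clinear_comp[OF clinear_tensor_right clinear_comp[OF clinear_tensor_right br1]]
    clinear_comp[OF clinear_tensor_right clinear_comp[OF clinear_tensor_right br2]]
  have B1: "clinear (\<lambda>x. B x y)" and B2: "clinear (B x)" for x y
    by (simp_all add: B_def clinear_bilin_ext_left clinear_bilin_ext_right)
  have C: "clinear (\<lambda>a. C a b a' b')" "clinear (\<lambda>b. C a b a' b')"
    "clinear (\<lambda>a'. C a b a' b')" "clinear (\<lambda>b'. C a b a' b')" for a b a' b'
    unfolding C_def by (intro lins)+
  have base: "B (basis i \<otimes> basis j) (basis k \<otimes> basis l) = C (basis i) (basis j) (basis k) (basis l)"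
    for i j k l by (simp add: B_def C_def)
  have half: "B (basis i \<otimes> basis j) (a' \<otimes> b') = C (basis i) (basis j) a' b'" for i j a' b'
    by (rule bilinear_eq_on_basis[where s = cscale and f = "\<lambda>a' b'. B (basis i \<otimes> basis j) (a' \<otimes> b')"])
      (use C base in \<open>auto intro!: clinear_comp[OF B2] clinear_tensor_left clinear_tensor_right
         simp del: tensor_basis\<close>)
  have BC: "B (a \<otimes> b) (a' \<otimes> b') = C a b a' b'" for a b a' b'
    by (rule bilinear_eq_on_basis[where s = cscale and f = "\<lambda>a b. B (a \<otimes> b) (a' \<otimes> b')"])
      (use C half in \<open>auto intro!: clinear_comp[OF B1] clinear_tensor_left clinear_tensor_right
         simp del: tensor_basis\<close>)
  have "cyb br r = B r r" by (simp add: cyb_def B_def)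
  also have "\<dots> = (\<Sum>i\<in>I. \<Sum>j\<in>I. B (a i \<otimes> b i) (a j \<otimes> b j))"
    by (simp only: r clinear_sum[OF B1]) (simp only: clinear_sum[OF B2])
  finally show ?thesis by (simp add: BC C_def sum.distrib)
qed

lemma bracket_basis [simp]: "bracket (basis g) (basis h) = gen_bracket g h"
  by (simp add: bracket_def)

lemma clinear_bracket: "clinear (bracket x)" "clinear (\<lambda>x. bracket x y)"
  by (simp_all add: bracket_def clinear_bilin_ext_left clinear_bilin_ext_right)

lemma bracket_antisym: "bracket x y = - bracket y x"
proof (rule bilinear_eq_on_basis[where s = cscale and f = bracket and g = "\<lambda>x y. - bracket y x"])
  fix g h show "bracket (basis g) (basis h) = - bracket (basis h) (basis g)"
    by (cases g; cases h) (auto intro!: poly_mapping_eqI simp: algebra_simps)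
qed (auto intro: clinear_uminus clinear_bracket)

theorem lie_algebra_bracket: "lie_algebra bracket"
proof -
  have "bracket x x = 0" for x
  proof (rule poly_mapping_eqI)
    fix k
    have "Poly_Mapping.lookup (bracket x x) k = - Poly_Mapping.lookup (bracket x x) k"
      using bracket_antisym[of x x] by (metis lookup_uminus)
    then show "Poly_Mapping.lookup (bracket x x) k = Poly_Mapping.lookup 0 k" by simp
  qed
  moreover have "bracket x (bracket y z) + bracket y (bracket z x) + bracket z (bracket x y) = 0"
    for x y z
  proof -
    let ?J = "\<lambda>x y z. bracket x (bracket y z) + bracket y (bracket z x) + bracket z (bracket x y)"
    have J: "clinear (\<lambda>x. ?J x y z)" "clinear (\<lambda>y. ?J x y z)" "clinear (\<lambda>z. ?J x y z)" for x y z
      by (intro clinear_plus clinear_bracket clinear_comp[OF clinear_bracket(1) clinear_bracket(1)]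
          clinear_comp[OF clinear_bracket(1) clinear_bracket(2)])+
    have base: "?J (basis f) (basis g) (basis h) = 0" for f g h
      by (cases f; cases g; cases h)
        (simp_all add: clinear_scale[OF clinear_bracket(1)] clinear_zero[OF clinear_bracket(1)]
          cvec.scale_left_distrib[symmetric] add.assoc add.left_commute add.commute,
         auto intro!: poly_mapping_eqI simp: lookup_add lookup_single when_def algebra_simps)
    have "?J (basis f) (basis g) z = 0" for f g
      by (rule linear_eq_on_basis[OF J(3) clinear_zero_map]) (rule base)
    then show ?thesis
      by (rule bilinear_eq_on_basis[OF J(1) J(2) clinear_zero_map clinear_zero_map])
  qed
  ultimately show ?thesis by (simp add: lie_algebra_def clinear_bracket)
qed

end

theory Submission
  imports Defs
begin

text \<open>
  The proof has two independent parts: \<open>\<Delta>\<close> is an inner derivation into the tensor square, and the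
  Yang--Baxter element of the resulting \<open>r\<close> vanishes.  One device is used over and over: if \<open>m\<close> is
  large, then \<open>L m\<close> moves each tensor factor of a fixed finite sum so far that its actions on the
  different factors cannot cancel, and on each factor it multiplies by a nonzero number.  Hence an
  element killed by all \<open>L m\<close> with \<open>m\<close> large is zero (\<open>witt_act_eventually_injective\<close>).

  Call the span of the \<open>L m\<close> the Witt algebra.  With \<open>t n\<close> standing for \<open>L n\<close>, \<open>W n\<close> or \<open>Z n\<close>, the
  brackets with \<open>L m\<close> have the shape \<open>[L m, t n] = - (n + a m) t (m + n)\<close>, where \<open>a\<close> is -1, 1 or 3.
  So, as a Witt module, the tensor square is the sum of nine modules \<open>F a \<otimes> F b\<close> of finitely supported
  arrays, and \<open>\<Delta>\<close> restricted to the Witt algebra is a family of nine cocycles.  These are coboundaries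
  (\<open>witt_cocycle_is_coboundary\<close>), apart from one class in \<open>F 1 \<otimes> F 1\<close> that is symmetric and therefore
  excluded by the skew-symmetry of \<open>\<Delta>\<close>.  To see this, use the diagonal action of \<open>L 0\<close> to make the
  cocycle homogeneous of degree zero.  For positive \<open>m\<close> the entries with the lowest first index form
  a cocycle of the positive half of the Witt algebra with values in \<open>F b\<close>, and such a cocycle is
  known explicitly (\<open>positive_witt_cocycle\<close>); subtracting coboundaries, one can push the support
  of the values at all positive \<open>m\<close> into the quadrant of nonnegative indices.  Comparing with \<open>L (-1)\<close>
  then leaves a few unknown numbers, which linear equations determine.

  A derivation that vanishes on the Witt algebra restricts to a Witt module map on the span of the
  \<open>W n\<close>.  As \<open>[L m, W (- m)] = 0\<close>, the operator \<open>L m L (- m)\<close> kills its value at \<open>W 0\<close>, so that this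
  value is zero by the separation argument; the \<open>L m\<close> carry \<open>W 0\<close> to all other \<open>W n\<close>, and these
  generate the \<open>Z n\<close> (\<open>tensor_derivation_zero\<close>).  Thus \<open>\<Delta>\<close> is inner, and \<open>r\<close> can be
  replaced by its skew-symmetric part.

  For the second part, write \<open>s\<close> for the action of \<open>x\<close> on the first factor of \<open>c(r)\<close>.  The Jacobi
  identity and the skew-symmetry of \<open>r\<close> turn the co-Jacobi condition at \<open>x\<close> into
  \<open>s + \<xi> s + \<xi>\<^sup>2 s = 0\<close> (\<open>coJacobi_coboundary\<close>).  For \<open>x = L m\<close> with \<open>m\<close> large the three summands
  have disjoint supports, which forces \<open>c(r) = 0\<close>.
\<close>

section \<open>Cocycles of the Witt algebra with values in tensor density modules\<close>

text \<open>
  The action of \<open>L m\<close> on \<open>F a \<otimes> F b\<close>, where \<open>F a\<close> has the basis \<open>t n\<close> and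
  \<open>L m \<cdot> t n = - (n + a m) t (m + n)\<close>.  A tensor is represented by its array of coefficients; the
  entry at \<open>(i, j)\<close> belongs to \<open>t i \<otimes> t j\<close>.
\<close>
definition witt_act :: "int \<Rightarrow> int \<Rightarrow> int \<Rightarrow> (int \<Rightarrow> int \<Rightarrow> complex) \<Rightarrow> int \<Rightarrow> int \<Rightarrow> complex" where
  "witt_act a b m v i j =
     - of_int (i - m + a * m) * v (i - m) j - of_int (j - m + b * m) * v i (j - m)"

definition finsupp :: "(int \<Rightarrow> int \<Rightarrow> complex) \<Rightarrow> bool" where
  "finsupp v \<longleftrightarrow> finite {(i, j). v i j \<noteq> 0}"

definition witt_cocycle :: "int \<Rightarrow> int \<Rightarrow> (int \<Rightarrow> int \<Rightarrow> int \<Rightarrow> complex) \<Rightarrow> bool" where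
  "witt_cocycle a b P \<longleftrightarrow> (\<forall>m. finsupp (P m)) \<and>
     (\<forall>m n i j. of_int (m - n) * P (m + n) i j
        = witt_act a b m (P n) i j - witt_act a b n (P m) i j)"

lemma witt_cocycleD:
  "witt_cocycle a b P \<Longrightarrow> of_int (m - n) * P (m + n) i j
     = witt_act a b m (P n) i j - witt_act a b n (P m) i j"
  by (simp add: witt_cocycle_def)

lemma witt_cocycle_finsupp: "witt_cocycle a b P \<Longrightarrow> finsupp (P m)"
  by (simp add: witt_cocycle_def)

lemma finsupp_subset:
  assumes "finsupp v" and "\<And>i j. w i j \<noteq> 0 \<Longrightarrow> v i j \<noteq> 0"
  shows "finsupp w"
proof -
  have "{(i, j). w i j \<noteq> 0} \<subseteq> {(i, j). v i j \<noteq> 0}" using assms(2) by auto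
  then show ?thesis using assms(1) unfolding finsupp_def by (rule finite_subset)
qed

lemma finsupp_diff:
  assumes "finsupp v" "finsupp w" shows "finsupp (\<lambda>i j. v i j - w i j)"
proof -
  have "{(i, j). v i j - w i j \<noteq> 0} \<subseteq> {(i, j). v i j \<noteq> 0} \<union> {(i, j). w i j \<noteq> 0}" by auto
  then show ?thesis using assms unfolding finsupp_def by (meson finite_UnI finite_subset)
qed

lemma finsupp_add:
  assumes "finsupp v" "finsupp w" shows "finsupp (\<lambda>i j. v i j + w i j)"
proof -
  have "{(i, j). v i j + w i j \<noteq> 0} \<subseteq> {(i, j). v i j \<noteq> 0} \<union> {(i, j). w i j \<noteq> 0}" by auto
  then show ?thesis using assms unfolding finsupp_def by (meson finite_UnI finite_subset)
qed

lemma finsupp_transpose: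
  assumes "finsupp v" shows "finsupp (\<lambda>i j. v j i)"
proof -
  have "{(i, j). v j i \<noteq> 0} = prod.swap ` {(i, j). v i j \<noteq> 0}" by force
  then show ?thesis using assms by (simp add: finsupp_def)
qed

lemma finsupp_delta: "finsupp (\<lambda>i j. if i = k \<and> j = l then c else 0)"
  unfolding finsupp_def by (rule finite_subset[of _ "{(k, l)}"]) (auto split: if_splits)

lemma finsupp_witt_act:
  assumes "finsupp v" shows "finsupp (witt_act a b m v)"
proof -
  let ?S = "{(i, j). v i j \<noteq> 0}"
  have "{(i, j). witt_act a b m v i j \<noteq> 0} \<subseteq> (\<lambda>(i, j). (i + m, j)) ` ?S \<union> (\<lambda>(i, j). (i, j + m)) ` ?S"
  proof clarsimp
    fix i j assume *: "witt_act a b m v i j \<noteq> 0" "(i, j) \<notin> (\<lambda>(i, j). (i, j + m)) ` ?S"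
    have "v i (j - m) = 0"
    proof (rule ccontr)
      assume "v i (j - m) \<noteq> 0"
      then have "(i, j) \<in> (\<lambda>(i, j). (i, j + m)) ` ?S" by (intro image_eqI[of _ _ "(i, j - m)"]) auto
      with * show False by simp
    qed
    with * have "v (i - m) j \<noteq> 0" by (auto simp: witt_act_def)
    then show "(i, j) \<in> (\<lambda>(i, j). (i + m, j)) ` ?S" by (intro image_eqI[of _ _ "(i - m, j)"]) auto
  qed
  then show ?thesis using assms unfolding finsupp_def by (meson finite_UnI finite_imageI finite_subset)
qed

lemma finsupp_bound:
  assumes "finsupp v"
  obtains K where "\<And>i j. v i j \<noteq> 0 \<Longrightarrow> \<bar>i\<bar> < K \<and> \<bar>j\<bar> < K"
proof -
  let ?S = "(\<lambda>(i, j). \<bar>i\<bar> + \<bar>j\<bar>) ` {(i, j). v i j \<noteq> 0}"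
  have fin: "finite ?S" using assms by (simp add: finsupp_def)
  have "\<bar>i\<bar> < Max ?S + 1 \<and> \<bar>j\<bar> < Max ?S + 1" if "v i j \<noteq> 0" for i j
  proof -
    have "\<bar>i\<bar> + \<bar>j\<bar> \<le> Max ?S" using that by (intro Max_ge[OF fin]) force
    then show ?thesis by linarith
  qed
  then show ?thesis using that by blast
qed

lemma of_int_nonzero: "k \<noteq> 0 \<Longrightarrow> (of_int k :: complex) \<noteq> 0"
  by simp

lemma witt_act_diff:
  "witt_act a b m (\<lambda>i j. v i j - w i j) i j = witt_act a b m v i j - witt_act a b m w i j"
  by (simp add: witt_act_def algebra_simps)

lemma witt_act_add:
  "witt_act a b m (\<lambda>i j. v i j + w i j) i j = witt_act a b m v i j + witt_act a b m w i j"
  by (simp add: witt_act_def algebra_simps)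

lemma witt_act_scale:
  "witt_act a b m (\<lambda>i j. c * v i j) i j = c * witt_act a b m v i j"
  by (simp add: witt_act_def algebra_simps)

lemma witt_act_transpose: "witt_act a b m (\<lambda>i j. v j i) i j = witt_act b a m v j i"
  by (simp add: witt_act_def algebra_simps)

lemma witt_act_commutator:
  "witt_act a b m (witt_act a b n v) i j - witt_act a b n (witt_act a b m v) i j
     = of_int (m - n) * witt_act a b (m + n) v i j"
proof -
  have [simp]: "i - n - m = i - (m + n)" "j - n - m = j - (m + n)"
    "i - m - n = i - (m + n)" "j - m - n = j - (m + n)" by simp_all
  show ?thesis by (simp add: witt_act_def) (simp add: algebra_simps)
qed

lemma witt_cocycle_diff_coboundary:
  assumes P: "witt_cocycle a b P" and v: "finsupp v"
  shows "witt_cocycle a b (\<lambda>m i j. P m i j - witt_act a b m v i j)"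
  unfolding witt_cocycle_def
proof (intro conjI allI)
  fix m show "finsupp (\<lambda>i j. P m i j - witt_act a b m v i j)"
    by (rule finsupp_diff[OF witt_cocycle_finsupp[OF P] finsupp_witt_act[OF v]])
next
  fix m n i j
  show "of_int (m - n) * (P (m + n) i j - witt_act a b (m + n) v i j)
    = witt_act a b m (\<lambda>i j. P n i j - witt_act a b n v i j) i j
    - witt_act a b n (\<lambda>i j. P m i j - witt_act a b m v i j) i j"
    unfolding witt_act_diff right_diff_distrib witt_cocycleD[OF P] witt_act_commutator[symmetric]
    by simp
qed

lemma witt_cocycle_transpose:
  assumes "witt_cocycle a b P" shows "witt_cocycle b a (\<lambda>m i j. P m j i)"
  unfolding witt_cocycle_def
proof (intro conjI allI)
  fix m show "finsupp (\<lambda>i j. P m j i)"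
    by (rule finsupp_transpose[OF witt_cocycle_finsupp[OF assms]])
next
  fix m n i j
  show "of_int (m - n) * P (m + n) j i
    = witt_act b a m (\<lambda>i j. P n j i) i j - witt_act b a n (\<lambda>i j. P m j i) i j"
    unfolding witt_cocycleD[OF assms] witt_act_transpose[of b a _ "P n"] witt_act_transpose[of b a _ "P m"]
    ..
qed

lemma witt_cocycle_diff:
  assumes "witt_cocycle a b P" "witt_cocycle a b Q"
  shows "witt_cocycle a b (\<lambda>m i j. P m i j - Q m i j)"
  using assms unfolding witt_cocycle_def
  by (auto intro: finsupp_diff simp: witt_act_diff right_diff_distrib)

text \<open>
  If \<open>m\<close> exceeds all indices in the support of \<open>v\<close>, then the entry at \<open>(i + m, j)\<close> can only come from
  the action on the first factor.
\<close>
lemma witt_act_eventually_injective: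
  assumes a: "a \<noteq> 0" and v: "finsupp v" and 0: "\<And>m i j. m \<ge> M \<Longrightarrow> witt_act a b m v i j = 0"
  shows "v i j = 0"
proof -
  obtain K where K: "\<And>i j. v i j \<noteq> 0 \<Longrightarrow> \<bar>i\<bar> < K \<and> \<bar>j\<bar> < K" using finsupp_bound[OF v] by blast
  define m where "m = max M 0 + \<bar>K\<bar> + \<bar>i\<bar> + 1"
  have m: "m \<ge> \<bar>K\<bar> + \<bar>i\<bar> + 1" by (simp add: m_def)
  have "v (i + m) (j - m) = 0"
  proof (rule ccontr)
    assume "v (i + m) (j - m) \<noteq> 0"
    then show False using K m by fastforce
  qed
  moreover have "witt_act a b m v (i + m) j = 0" by (rule 0) (simp add: m_def)
  moreover have "i + a * m \<noteq> 0"
  proof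
    assume "i + a * m = 0"
    then have "\<bar>i\<bar> = \<bar>a\<bar> * \<bar>m\<bar>" by (metis abs_minus abs_mult add_eq_0_iff)
    moreover have "1 * \<bar>m\<bar> \<le> \<bar>a\<bar> * \<bar>m\<bar>" using a by (intro mult_right_mono) auto
    ultimately show False by (simp add: m_def)
  qed
  then have "(of_int (i + a * m) :: complex) \<noteq> 0" by (rule of_int_nonzero)
  ultimately show ?thesis by (simp add: witt_act_def del: of_int_add of_int_mult)
qed

text \<open>
  \<open>L 1\<close> and \<open>L 2\<close> generate all \<open>L n\<close> with \<open>n\<close> positive.  For arbitrary \<open>m\<close>, the bracket of \<open>L m\<close>
  with \<open>L n\<close>, \<open>n\<close> large, is again in this part, so that \<open>L n\<close> kills the value at \<open>m\<close>.
\<close>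
lemma witt_cocycle_zeroI:
  assumes P: "witt_cocycle a b P" and a: "a \<noteq> 0"
    and P1: "\<And>i j. P 1 i j = 0" and P2: "\<And>i j. P 2 i j = 0"
  shows "P m i j = 0"
proof -
  have pos: "P (int n + 1) i j = 0" for n i j
  proof (induction n arbitrary: i j rule: less_induct)
    case (less n)
    show ?case
    proof (cases "n \<le> 1")
      case True
      then have "n = 0 \<or> n = 1" by auto
      then show ?thesis using P1 P2 by auto
    next
      case False
      have "P (int n) i j = 0" for i j using less.IH[of "n - 1" i j] False by (simp add: of_nat_diff)
      then have "of_int (int n - 1) * P (int n + 1) i j = 0"
        by (simp only: witt_cocycleD[OF P]) (simp add: witt_act_def P1)
      moreover have "(of_int (int n - 1) :: complex) \<noteq> 0" by (rule of_int_nonzero) (use False in simp)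
      ultimately show ?thesis by simp
    qed
  qed
  have pos: "P n i j = 0" if "n > 0" for n i j using pos[of "nat (n - 1)" i j] that by simp
  show ?thesis
  proof (rule witt_act_eventually_injective[OF a witt_cocycle_finsupp[OF P]])
    fix n i j assume n: "\<bar>m\<bar> + 1 \<le> n"
    then have "of_int (n - m) * P (n + m) i j = 0" by (simp add: pos)
    then show "witt_act a b n (P m) i j = 0"
      using n by (simp only: witt_cocycleD[OF P]) (simp add: witt_act_def pos)
  qed
qed

definition homogeneous :: "(int \<Rightarrow> int \<Rightarrow> int \<Rightarrow> complex) \<Rightarrow> bool" where
  "homogeneous P \<longleftrightarrow> (\<forall>m i j. i + j \<noteq> m \<longrightarrow> P m i j = 0)"

text \<open>
  \<open>L 0\<close> acts on \<open>t i \<otimes> t j\<close> as multiplication by \<open>- (i + j)\<close>.  Where this is nonzero, the cocycle is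
  therefore determined by its value at \<open>L 0\<close>, and it is the coboundary of that value divided by
  the eigenvalue.
\<close>
lemma witt_cocycle_homogenize:
  assumes P: "witt_cocycle a b P" and a: "a \<noteq> 0"
  obtains v where "finsupp v" "homogeneous (\<lambda>m i j. P m i j - witt_act a b m v i j)"
proof -
  define v where "v i j = - P 0 i j / of_int (i + j)" for i j
  have v: "finsupp v"
    by (rule finsupp_subset[OF witt_cocycle_finsupp[OF P, of 0]]) (auto simp: v_def)
  define Q where "Q = (\<lambda>m i j. P m i j - witt_act a b m v i j)"
  have Q: "witt_cocycle a b Q" unfolding Q_def by (rule witt_cocycle_diff_coboundary[OF P v])
  have Q0: "Q 0 i j = 0" if "i + j \<noteq> 0" for i j
  proof -
    have nz: "(of_int (i + j) :: complex) \<noteq> 0" by (rule of_int_nonzero) (use that in simp)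
    have "witt_act a b 0 v i j = - of_int (i + j) * v i j" by (simp add: witt_act_def algebra_simps)
    also have "\<dots> = P 0 i j" unfolding v_def using nz by (simp del: of_int_add)
    finally show ?thesis by (simp add: Q_def)
  qed
  have eq: "of_int (i + j - n) * Q n i j = - witt_act a b n (Q 0) i j" for n i j
    using witt_cocycleD[OF Q, of 0 n i j] by (simp add: witt_act_def algebra_simps)
  have hom: "Q n i j = 0" if "i + j \<noteq> n" for n i j
  proof -
    have "witt_act a b n (Q 0) i j = 0" using that by (simp add: witt_act_def Q0)
    moreover have "(of_int (i + j - n) :: complex) \<noteq> 0" by (rule of_int_nonzero) (use that in simp)
    ultimately show ?thesis using eq[of i j n] by simp
  qed
  show ?thesis using v hom by (intro that[of v]) (auto simp: homogeneous_def Q_def)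
qed

section \<open>Reduction of a cocycle to nonnegative indices\<close>

text \<open>
  The hypothesis says that \<open>u m\<close> is the coefficient of \<open>t (m - k)\<close> in a cocycle of the positive half of
  the Witt algebra with values in \<open>F b\<close>.  The sequence \<open>b m - k\<close> is, up to sign, the coboundary of
  \<open>t (- k)\<close>.  The sequence \<open>m\<^sup>2\<close>, which occurs for 1-forms only, is up to coboundaries the cocycle
  \<open>f \<partial> \<mapsto> f'' dx\<close>.  As \<open>L 1\<close> and \<open>L 2\<close> generate, the numbers \<open>u 1\<close> and \<open>u 2\<close> determine \<open>u\<close>, and a
  coboundary makes one of them zero.  Outside the exceptional case, comparing the two ways of
  computing \<open>u 5\<close>, and once also those of computing \<open>u 7\<close>, shows that the other one vanishes too.
\<close>
lemma positive_witt_cocycle: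
  fixes u :: "int \<Rightarrow> complex" and b k :: int
  assumes u: "\<And>m n. m > 0 \<Longrightarrow> n > 0 \<Longrightarrow>
      of_int (m - n) * u (m + n) = of_int (m - k + b * n) * u m - of_int (n - k + b * m) * u n"
    and b: "b \<in> {-1, 1, 3}"
  obtains c e where "\<And>m. m > 0 \<Longrightarrow> u m = c * of_int (b * m - k) + e * of_int (m ^ 2)"
    "e \<noteq> 0 \<Longrightarrow> b = 1 \<and> k = 0"
proof -
  have ext: "u m = c * of_int (b * m - k) + e * of_int (m ^ 2)"
    if m: "m > 0" and 1: "u 1 = c * of_int (b - k) + e" and 2: "u 2 = c * of_int (b * 2 - k) + 4 * e"
      and e: "e \<noteq> 0 \<Longrightarrow> b = 1 \<and> k = 0" for m c e
  proof -
    have "u (int n + 1) = c * of_int (b * (int n + 1) - k) + e * of_int ((int n + 1) ^ 2)" for n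
    proof (induction n rule: less_induct)
      case (less n)
      show ?case
      proof (cases "n \<le> 1")
        case True
        then have "n = 0 \<or> n = 1" by auto
        then show ?thesis using 1 2 by (auto simp: algebra_simps)
      next
        case False
        have IH: "u (int n) = c * of_int (b * int n - k) + e * of_int ((int n) ^ 2)"
          using less.IH[of "n - 1"] False by (simp add: of_nat_diff)
        have nz: "(of_int (int n - 1) :: complex) \<noteq> 0" by (rule of_int_nonzero) (use False in simp)
        have "of_int (int n - 1) * u (int n + 1)
          = of_int (int n - k + b) * u (int n) - of_int (1 - k + b * int n) * u 1"
          using u[of "int n" 1] False by simp
        also have "\<dots> = of_int (int n - 1)
            * (c * of_int (b * (int n + 1) - k) + e * of_int ((int n + 1) ^ 2))"
          using e unfolding IH 1
          by (cases "e = 0") (auto simp: algebra_simps power2_eq_square)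
        finally show ?thesis using nz by simp
      qed
    qed
    from this[of "nat (m - 1)"] m show ?thesis by simp
  qed
  have u3: "u 3 = of_int (2 - k + b) * u 2 - of_int (1 - k + b * 2) * u 1"
    using u[of 2 1] by simp
  have u4: "2 * u 4 = of_int (3 - k + b) * u 3 - of_int (1 - k + b * 3) * u 1"
    using u[of 3 1] by simp
  have u5: "3 * u 5 = of_int (4 - k + b) * u 4 - of_int (1 - k + b * 4) * u 1"
    using u[of 4 1] by simp
  have u6: "4 * u 6 = of_int (5 - k + b) * u 5 - of_int (1 - k + b * 5) * u 1"
    using u[of 5 1] by simp
  have u7: "5 * u 7 = of_int (6 - k + b) * u 6 - of_int (1 - k + b * 6) * u 1"
    using u[of 6 1] by simp
  have u5': "u 5 = of_int (3 - k + b * 2) * u 3 - of_int (2 - k + b * 3) * u 2"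
    using u[of 3 2] by simp
  have u7': "3 * u 7 = of_int (5 - k + b * 2) * u 5 - of_int (2 - k + b * 5) * u 2"
    using u[of 5 2] by simp
  show ?thesis
  proof (cases "b = 1 \<and> k = 0")
    case True
    let ?e = "(u 2 - 2 * u 1) / 2"
    show ?thesis
      by (rule that[of "u 1 - ?e" ?e], rule ext) (use True in \<open>auto simp: field_simps\<close>)
  next
    case nex: False
    show ?thesis
    proof (cases "k = b")
      case True
      have "3 * u 5 = 2 * (2 * u 4) - of_int (1 - k + b * 4) * u 1" using u5 True by simp
      then have "of_int (b * (3 * b - 1)) * u 1 = 0"
        unfolding u5' u4 u3 True by (simp add: algebra_simps)
      moreover have "(of_int (b * (3 * b - 1)) :: complex) \<noteq> 0"
        by (rule of_int_nonzero) (use b in auto)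
      ultimately have "u 1 = 0" by simp
      then show ?thesis
        by (intro that[of "u 2 / of_int b" 0] ext) (use True b in auto)
    next
      case False
      have half: "x = A / 2 + B" if "2 * x = A + 2 * B" for x A B :: complex
        using that by (simp add: field_simps)
      have third: "x = A / 6 + B" if "3 * x = A / 2 + 3 * B" for x A B :: complex
        using that by (simp add: field_simps)
      \<comment> \<open>\<open>y\<close> is what remains of \<open>u 2\<close> after the coboundary that normalizes \<open>u 1\<close> to zero; the two
        expressions for \<open>u 5\<close> multiply it by a quadratic polynomial in \<open>d\<close> which has an integer root
        only for \<open>b = 1\<close>, namely 1 (this is \<open>k = 0\<close>) and -4 (which \<open>u 7\<close> excludes).\<close>
      define d where "d = b - k"
      define c where "c = u 1 / of_int d"
      define y where "y = u 2 - c * of_int (b + d)"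
      have nzd: "(of_int d :: complex) \<noteq> 0" using False by (simp add: d_def)
      have u1: "u 1 = c * of_int d" using nzd by (simp add: c_def)
      have u2: "u 2 = y + c * of_int (b + d)" by (simp add: y_def)
      have k: "k = b - d" by (simp add: d_def)
      have v3: "u 3 = of_int (2 + d) * y + c * of_int (2 * b + d)"
        using u3 unfolding u1 u2 k by (simp add: algebra_simps)
      have "2 * u 4 = of_int ((3 + d) * (2 + d)) * y + 2 * (c * of_int (3 * b + d))"
        using u4 unfolding u1 v3 k by (simp add: algebra_simps)
      then have v4: "u 4 = of_int ((3 + d) * (2 + d)) * y / 2 + c * of_int (3 * b + d)"
        by (rule half)
      have "3 * u 5 = of_int ((4 + d) * (3 + d) * (2 + d)) * y / 2 + 3 * (c * of_int (4 * b + d))"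
        using u5 unfolding u1 v4 k by (simp add: field_simps)
      then have v5: "u 5 = of_int ((4 + d) * (3 + d) * (2 + d)) * y / 6 + c * of_int (4 * b + d)"
        by (rule third)
      have "of_int (d * (d * d + 3 * d + 2 - 6 * b)) * y = 0"
        using u5' unfolding v5 v3 u2 k by (simp add: field_simps)
      then have Y: "d * d + 3 * d + 2 - 6 * b = 0 \<or> y = 0" using nzd by (auto simp only: mult_eq_0_iff of_int_mult of_int_eq_0_iff) 
      have "y = 0"
      proof (rule ccontr)
        assume y: "y \<noteq> 0"
        have q: "d * (d + 3) = 6 * b - 2" using Y y by (simp add: algebra_simps)
        have "d < 4"
        proof (rule ccontr)
          assume "\<not> d < 4"
          then have "4 * 7 \<le> d * (d + 3)" by (intro mult_mono) auto
          then show False using q b by auto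
        qed
        moreover have "d > -7"
        proof (rule ccontr)
          assume "\<not> d > -7"
          then have "7 * 4 \<le> (- d) * (- (d + 3))" by (intro mult_mono) auto
          also have "\<dots> = d * (d + 3)" by (simp add: algebra_simps)
          finally show False using q b by auto
        qed
        ultimately have "d \<in> {-6, -5, -4, -3, -2, -1, 0, 1, 2, 3}" by (simp, presburger)
        then have db: "d = 1 \<and> b = 1 \<or> d = -4 \<and> b = 1" using q b by auto
        then show False
        proof
          assume "d = 1 \<and> b = 1"
          then show False using nex k by simp
        next
          assume *: "d = -4 \<and> b = 1"
          then have k5: "k = 5" using k by simp
          have c1: "u 1 = - (4 * c)" and c2: "u 2 = y - 3 * c" and c5: "u 5 = 0"
            using u1 u2 v5 * by simp_all
          have c6: "u 6 = c" using u6 unfolding c5 c1 k5 using * by simp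
          have c7: "u 7 = 2 * c" using u7 unfolding c6 c1 k5 using * by simp
          show False using u7' y unfolding c7 c5 c2 k5 using * by (simp add: algebra_simps)
        qed
      qed
      then show ?thesis
        by (intro that[of c 0] ext) (simp_all add: u1 u2 k algebra_simps)
    qed
  qed
qed

text \<open>
  A positive \<open>L n\<close> acting on the first factor raises the first index, so that at the lowest first
  index only the action on the second factor is visible.
\<close>
lemma lowest_index_coefficients:
  assumes P: "witt_cocycle a b P" and b: "b \<in> {-1, 1, 3}"
    and low: "\<And>m i j. m > 0 \<Longrightarrow> i < k \<Longrightarrow> P m i j = 0"
  obtains c e where "\<And>m. m > 0 \<Longrightarrow> P m k (m - k) = c * of_int (b * m - k) + e * of_int (m ^ 2)"
    "e \<noteq> 0 \<Longrightarrow> b = 1 \<and> k = 0"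
proof -
  have "of_int (m - n) * P (m + n) k (m + n - k)
      = of_int (m - k + b * n) * P m k (m - k) - of_int (n - k + b * m) * P n k (n - k)"
    if "m > 0" "n > 0" for m n
    unfolding witt_cocycleD[OF P] witt_act_def using low[of n "k - m"] low[of m "k - n"] that
    by (simp add: algebra_simps)
  then show ?thesis by (rule positive_witt_cocycle[OF _ b that])
qed

lemma positive_part_bounded_below:
  assumes P: "witt_cocycle a b P"
  obtains N :: nat where "\<And>m i j. m > 0 \<Longrightarrow> i < - int N \<Longrightarrow> P m i j = 0"
proof -
  obtain K1 where K1: "\<And>i j. P 1 i j \<noteq> 0 \<Longrightarrow> \<bar>i\<bar> < K1 \<and> \<bar>j\<bar> < K1"
    using finsupp_bound[OF witt_cocycle_finsupp[OF P]] by blast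
  obtain K2 where K2: "\<And>i j. P 2 i j \<noteq> 0 \<Longrightarrow> \<bar>i\<bar> < K2 \<and> \<bar>j\<bar> < K2"
    using finsupp_bound[OF witt_cocycle_finsupp[OF P]] by blast
  define N where "N = nat (max K1 K2)"
  have 1: "P 1 i j = 0" if "i < - int N" for i j using K1[of i j] that unfolding N_def by linarith
  have 2: "P 2 i j = 0" if "i < - int N" for i j using K2[of i j] that unfolding N_def by linarith
  have "P (int n + 1) i j = 0" if "i < - int N" for n i j
    using that
  proof (induction n arbitrary: i j rule: less_induct)
    case (less n)
    show ?case
    proof (cases "n \<le> 1")
      case True
      then have "n = 0 \<or> n = 1" by auto
      then show ?thesis using 1 2 less.prems by auto
    next
      case False
      have "P (int n) i j = 0" if "i < - int N" for i j
        using less.IH[of "n - 1" i j] False that by (simp add: of_nat_diff)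
      then have "of_int (int n - 1) * P (int n + 1) i j = 0"
        using less.prems by (simp only: witt_cocycleD[OF P]) (simp add: witt_act_def 1)
      moreover have "(of_int (int n - 1) :: complex) \<noteq> 0"
        by (rule of_int_nonzero) (use False in simp)
      ultimately show ?thesis by simp
    qed
  qed
  note pos = this
  show ?thesis
  proof (rule that[of N])
    fix m i j :: int assume "m > 0" "i < - int N"
    then show "P m i j = 0" using pos[of i "nat (m - 1)" j] by simp
  qed
qed

text \<open>
  The lowest negative first index \<open>k\<close> is removed by subtracting the coboundary of a multiple of
  \<open>t k \<otimes> t (- k)\<close>.  For positive \<open>m\<close> this coboundary has second indices at least \<open>- k > 0\<close>, so it does
  not disturb a lower bound \<open>l \<le> 0\<close> for the second indices.  This independence is what allows both
  indices to be treated one after the other.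
\<close>
lemma clear_negative_first_index:
  assumes "witt_cocycle a b P" "homogeneous P" and b: "b \<in> {-1, 1, 3}" and l: "l \<le> 0"
    and "\<And>m i j. m > 0 \<Longrightarrow> i < - int N \<Longrightarrow> P m i j = 0"
    and "\<And>m i j. m > 0 \<Longrightarrow> j < l \<Longrightarrow> P m i j = 0"
  shows "\<exists>v. finsupp v \<and> (\<forall>i j. i + j \<noteq> 0 \<longrightarrow> v i j = 0)
    \<and> (\<forall>m i j. m > 0 \<longrightarrow> i < 0 \<or> j < l \<longrightarrow> P m i j - witt_act a b m v i j = 0)"
  using assms(1,2,5,6)
proof (induction N arbitrary: P)
  case 0
  then show ?case
    by (intro exI[of _ "\<lambda>i j. 0"]) (auto simp: finsupp_def witt_act_def)
next
  case (Suc N)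
  note P = Suc.prems(1) and hom = Suc.prems(2) and low = Suc.prems(3) and lowj = Suc.prems(4)
  define k where "k = - int (Suc N)"
  have k: "k < 0" by (simp add: k_def)
  obtain c e where c: "\<And>m. m > 0 \<Longrightarrow> P m k (m - k) = c * of_int (b * m - k) + e * of_int (m ^ 2)"
    and e: "e \<noteq> 0 \<Longrightarrow> b = 1 \<and> k = 0"
    by (rule lowest_index_coefficients[OF P b low[folded k_def]]) auto
  have e0: "e = 0" using e k by auto
  \<comment> \<open>the exceptional sequence \<open>m\<^sup>2\<close> belongs to \<open>k = 0\<close> and does not occur for negative \<open>k\<close>\<close>
  define w where "w = (\<lambda>i j. if i = k \<and> j = - k then - c else 0)"
  have w: "finsupp w" unfolding w_def by (rule finsupp_delta)
  define Q where "Q = (\<lambda>m i j. P m i j - witt_act a b m w i j)"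
  have Q: "witt_cocycle a b Q" unfolding Q_def by (rule witt_cocycle_diff_coboundary[OF P w])
  have homQ: "homogeneous Q" using hom unfolding homogeneous_def Q_def by (auto simp: witt_act_def w_def)
  have lowQ: "Q m i j = 0" if "m > 0" "i < - int N" for m i j
  proof (cases "i = k \<and> j = m - k")
    case True
    have "witt_act a b m w k (m - k) = c * of_int (b * m - k)"
      using that by (simp add: witt_act_def w_def algebra_simps)
    then show ?thesis using True c[OF that(1)] e0 by (simp add: Q_def)
  next
    case False
    have "P m i j = 0"
    proof (cases "i = k")
      case True
      then show ?thesis using False hom by (auto simp: homogeneous_def)
    next
      case i: False
      then show ?thesis using that low[of m i j] by (simp add: k_def)
    qed
    moreover have "witt_act a b m w i j = 0"
      using False that by (auto simp: witt_act_def w_def k_def)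
    ultimately show ?thesis by (simp add: Q_def)
  qed
  have lowjQ: "Q m i j = 0" if "m > 0" "j < l" for m i j
    using lowj[OF that] that l k by (simp add: Q_def witt_act_def w_def)
  from Suc.IH[OF Q homQ lowQ lowjQ] obtain v where v: "finsupp v" "\<And>i j. i + j \<noteq> 0 \<Longrightarrow> v i j = 0"
    "\<And>m i j. m > 0 \<Longrightarrow> i < 0 \<or> j < l \<Longrightarrow> Q m i j - witt_act a b m v i j = 0"
    by blast
  show ?case
  proof (intro exI conjI allI impI)
    show "finsupp (\<lambda>i j. w i j + v i j)" by (rule finsupp_add[OF w v(1)])
    show "w i j + v i j = 0" if "i + j \<noteq> 0" for i j using v(2)[OF that] that by (auto simp: w_def)
    show "P m i j - witt_act a b m (\<lambda>i j. w i j + v i j) i j = 0" if "m > 0" "i < 0 \<or> j < l" for m i j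
      using v(3)[OF that] unfolding witt_act_add by (simp add: Q_def algebra_simps)
  qed
qed

lemma homogeneous_transpose:
  assumes "homogeneous P" shows "homogeneous (\<lambda>m i j. P m j i)"
  unfolding homogeneous_def
proof (intro allI impI)
  fix m i j :: int assume "i + j \<noteq> m"
  then have "j + i \<noteq> m" by (simp add: add.commute)
  then show "P m j i = 0" using assms unfolding homogeneous_def by blast
qed

lemma homogeneous_diff_coboundary:
  assumes "homogeneous P" "\<And>i j. i + j \<noteq> 0 \<Longrightarrow> v i j = 0"
  shows "homogeneous (\<lambda>m i j. P m i j - witt_act a b m v i j)"
  using assms by (auto simp: homogeneous_def witt_act_def)

lemma witt_cocycle_to_quadrant:
  assumes P: "witt_cocycle a b P" and ab: "a \<in> {-1, 1, 3}" "b \<in> {-1, 1, 3}"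
  obtains v where "finsupp v" "homogeneous (\<lambda>m i j. P m i j - witt_act a b m v i j)"
    "\<And>m i j. m > 0 \<Longrightarrow> i < 0 \<or> j < 0 \<Longrightarrow> P m i j - witt_act a b m v i j = 0"
proof -
  have a0: "a \<noteq> 0" using ab by auto
  obtain v1 where v1: "finsupp v1" "homogeneous (\<lambda>m i j. P m i j - witt_act a b m v1 i j)"
    using witt_cocycle_homogenize[OF P a0] by blast
  define P1 where "P1 = (\<lambda>m i j. P m i j - witt_act a b m v1 i j)"
  have P1: "witt_cocycle a b P1" unfolding P1_def by (rule witt_cocycle_diff_coboundary[OF P v1(1)])
  have P1h: "homogeneous P1" unfolding P1_def by (rule v1(2))
  obtain N where N: "\<And>m i j. m > 0 \<Longrightarrow> i < - int N \<Longrightarrow> P1 m i j = 0"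
    by (rule positive_part_bounded_below[OF P1]) (rule that)
  obtain N' where N': "\<And>m i j. m > 0 \<Longrightarrow> j < - int N' \<Longrightarrow> P1 m i j = 0"
    by (rule positive_part_bounded_below[OF witt_cocycle_transpose[OF P1]]) (rule that)
  have neg: "- int N' \<le> 0" by simp
  have "\<exists>v. finsupp v \<and> (\<forall>i j. i + j \<noteq> 0 \<longrightarrow> v i j = 0)
    \<and> (\<forall>m i j. m > 0 \<longrightarrow> i < 0 \<or> j < - int N' \<longrightarrow> P1 m i j - witt_act a b m v i j = 0)"
    by (rule clear_negative_first_index[OF P1 P1h ab(2) neg, of N]) (fact N, fact N')
  then obtain v2 where v2: "finsupp v2" "\<And>i j. i + j \<noteq> 0 \<Longrightarrow> v2 i j = 0"
    "\<And>m i j. m > 0 \<Longrightarrow> i < 0 \<or> j < - int N' \<Longrightarrow> P1 m i j - witt_act a b m v2 i j = 0"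
    by blast
  define P2 where "P2 = (\<lambda>m i j. P1 m i j - witt_act a b m v2 i j)"
  have P2: "witt_cocycle a b P2" unfolding P2_def by (rule witt_cocycle_diff_coboundary[OF P1 v2(1)])
  have P2h: "homogeneous P2" unfolding P2_def by (rule homogeneous_diff_coboundary[OF P1h v2(2)])
  have P2t: "witt_cocycle b a (\<lambda>m i j. P2 m j i)" "homogeneous (\<lambda>m i j. P2 m j i)"
    by (rule witt_cocycle_transpose[OF P2], rule homogeneous_transpose[OF P2h])
  have lowi: "P2 m i j = 0" if "m > 0" "i < 0" for m i j unfolding P2_def using v2(3) that by blast
  have lowj: "P2 m i j = 0" if "m > 0" "j < - int N'" for m i j unfolding P2_def using v2(3) that by blast
  have "\<exists>w. finsupp w \<and> (\<forall>i j. i + j \<noteq> 0 \<longrightarrow> w i j = 0)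
    \<and> (\<forall>m i j. m > 0 \<longrightarrow> i < 0 \<or> j < 0 \<longrightarrow> P2 m j i - witt_act b a m w i j = 0)"
    by (rule clear_negative_first_index[OF P2t ab(1) order_refl, of N']) (fact lowj, fact lowi)
  then obtain w where w: "finsupp w" "\<And>i j. i + j \<noteq> 0 \<Longrightarrow> w i j = 0"
    "\<And>m i j. m > 0 \<Longrightarrow> i < 0 \<or> j < 0 \<Longrightarrow> P2 m j i - witt_act b a m w i j = 0"
    by blast
  define v3 where "v3 = (\<lambda>i j. w j i)"
  have v3: "finsupp v3" "\<And>i j. i + j \<noteq> 0 \<Longrightarrow> v3 i j = 0"
    unfolding v3_def by (rule finsupp_transpose[OF w(1)]) (simp add: w(2) add.commute)
  have v3': "P2 m i j - witt_act a b m v3 i j = 0" if "m > 0" "i < 0 \<or> j < 0" for m i j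
    unfolding v3_def witt_act_transpose[of a b m w] using w(3)[of m j i] that by auto
  let ?v = "\<lambda>i j. v1 i j + v2 i j + v3 i j"
  have eq: "P m i j - witt_act a b m ?v i j = P2 m i j - witt_act a b m v3 i j" for m i j
    unfolding witt_act_add by (simp add: P2_def P1_def)
  show ?thesis
  proof (rule that[of ?v])
    show "finsupp ?v" by (intro finsupp_add v1 v2 v3)
    show "homogeneous (\<lambda>m i j. P m i j - witt_act a b m ?v i j)"
      unfolding eq by (rule homogeneous_diff_coboundary[OF P2h v3(2)])
    show "P m i j - witt_act a b m ?v i j = 0" if "m > 0" "i < 0 \<or> j < 0" for m i j
      unfolding eq by (rule v3'[OF that])
  qed
qed

section \<open>Vanishing of the cohomology\<close>

text \<open>
  The bracket \<open>[L n, L (-1)]\<close> for large \<open>n\<close>, read at \<open>(i + n, - 1 - i)\<close>, isolates the action of \<open>L n\<close> on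
  the first factor of the value at \<open>L (-1)\<close>.  For \<open>i > 0\<close> the positive part contributes
  nothing there, and for \<open>i = 0\<close> it contributes its border entry at \<open>(n, 0)\<close>.  As the value at \<open>L (-1)\<close>
  is independent of \<open>n\<close>, the quadratic term in the border entries must vanish.
\<close>
lemma quadrant_cocycle_boundary:
  assumes P: "witt_cocycle a b P" and hom: "homogeneous P" and ab: "a \<in> {-1, 1, 3}" "b \<in> {-1, 1, 3}"
    and low: "\<And>m i j. m > 0 \<Longrightarrow> i < 0 \<or> j < 0 \<Longrightarrow> P m i j = 0"
  obtains c where "\<And>m. m > 0 \<Longrightarrow> P m m 0 = c * of_int (a * m)" "P (-1) 0 (-1) = - c * of_int b"
    "\<And>i j. i > 0 \<Longrightarrow> P (-1) i j = 0"
proof -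
  obtain K where K: "\<And>i j. P (-1) i j \<noteq> 0 \<Longrightarrow> \<bar>i\<bar> < K \<and> \<bar>j\<bar> < K"
    using finsupp_bound[OF witt_cocycle_finsupp[OF P]] by blast
  obtain c e where c: "\<And>m. m > 0 \<Longrightarrow> P m (m - 0) 0 = c * of_int (a * m - 0) + e * of_int (m ^ 2)"
    by (rule lowest_index_coefficients[OF witt_cocycle_transpose[OF P] ab(1), of 0]) (use low in auto)
  have key: "of_int (i + a * n) * P (-1) i (- 1 - i) = - of_int (i + b) * P n (i + n) (- i)"
    if n: "n > \<bar>K\<bar> + 1" "i \<ge> 0" for n i
  proof -
    have "P (-1) (i + n) (- 1 - i - n) = 0"
    proof (rule ccontr)
      assume "P (-1) (i + n) (- 1 - i - n) \<noteq> 0"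
      then show False using K n by fastforce
    qed
    moreover have "P (n - 1) (i + n) (- 1 - i) = 0" "P n (i + n + 1) (- 1 - i) = 0"
      using low n by auto
    ultimately have "witt_act a b n (P (-1)) (i + n) (- 1 - i) = - of_int (i + a * n) * P (-1) i (- 1 - i)"
      "witt_act a b (-1) (P n) (i + n) (- 1 - i) = of_int (i + b) * P n (i + n) (- i)"
      "P (n + - 1) (i + n) (- 1 - i) = 0"
      by (simp_all add: witt_act_def) (simp add: algebra_simps)
    then have "0 = - of_int (i + a * n) * P (-1) i (- 1 - i) - of_int (i + b) * P n (i + n) (- i)"
      using witt_cocycleD[OF P, of n "-1" "i + n" "- 1 - i"] by simp
    then show ?thesis by algebra
  qed
  have b0: "(of_int b :: complex) \<noteq> 0" and a0: "(of_int a :: complex) \<noteq> 0" using ab by auto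
  have diag: "of_int a * P (-1) 0 (-1) = - of_int b * (c * of_int a + e * of_int n)"
    if n: "n > \<bar>K\<bar> + 1" for n
  proof -
    have "of_int n * (of_int a * P (-1) 0 (-1)) = of_int n * (- of_int b * (c * of_int a + e * of_int n))"
      using key[OF n, of 0] c[of n] n by (simp add: algebra_simps power2_eq_square)
    moreover have "(of_int n :: complex) \<noteq> 0" using n by simp
    ultimately show ?thesis by (simp only: mult_cancel_left) simp
  qed
  have "e = 0" using diag[of "\<bar>K\<bar> + 2"] diag[of "\<bar>K\<bar> + 3"] b0 by (simp add: algebra_simps)
  show ?thesis
  proof (rule that[of c])
    show "P m m 0 = c * of_int (a * m)" if "m > 0" for m using c[OF that] \<open>e = 0\<close> by simp
    show "P (-1) 0 (-1) = - c * of_int b"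
    proof -
      have "of_int a * P (-1) 0 (-1) = of_int a * (- c * of_int b)"
        using diag[of "\<bar>K\<bar> + 2"] \<open>e = 0\<close> by (simp add: algebra_simps)
      then show ?thesis using a0 by (simp only: mult_cancel_left) simp
    qed
    show "P (-1) i j = 0" if "i > 0" for i j
    proof (cases "j = - 1 - i")
      case True
      define n where "n = \<bar>K\<bar> + 2 + i"
      have "i + a * n \<noteq> 0" using ab that by (auto simp: n_def)
      then have "(of_int (i + a * n) :: complex) \<noteq> 0" by (rule of_int_nonzero)
      moreover have "P n (i + n) (- i) = 0" using low that by (auto simp: n_def)
      ultimately show ?thesis using key[of n i] that True by (simp add: n_def del: of_int_add)
    next
      case False
      then show ?thesis using hom by (auto simp: homogeneous_def)
    qed
  qed
qed

text \<open>
  After the reduction to the quadrant, the values at \<open>L 1\<close>, \<open>L 2\<close> and \<open>L (-1)\<close> are described by two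
  numbers \<open>c\<close> and \<open>d\<close> on the borders and the entry \<open>g\<close> at \<open>(1, 1)\<close>.  The relation
  \<open>[L 2, L (-1)] = 3 L 1\<close> gives \<open>c = d\<close>, so that the coboundary of \<open>t 0 \<otimes> t 0\<close> clears the borders, and
  \<open>g = 0\<close> unless \<open>a = b = 1\<close>.

  For \<open>a = b = 1\<close> the array with the entries \<open>i (m - i)\<close> at \<open>(i, m - i)\<close>, \<open>0 < i < m\<close>, is a genuine
  obstruction: up to sign it is the value at \<open>L m\<close>, \<open>m > 0\<close>, of the formal coboundary of \<open>dx dy / (x - y)\<^sup>2\<close>.  It is symmetric, and it cancels
  when a skew-symmetric cocycle is antisymmetrized.
\<close>
theorem witt_cocycle_is_coboundary:
  assumes P: "witt_cocycle a b P" and ab: "a \<in> {-1, 1, 3}" "b \<in> {-1, 1, 3}"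
    and skew: "a = 1 \<Longrightarrow> b = 1 \<Longrightarrow> (\<And>m i j. P m j i = - P m i j)"
  obtains v where "finsupp v" "\<And>m i j. P m i j = witt_act a b m v i j"
proof -
  have a0: "a \<noteq> 0" using ab by auto
  obtain v1 where v1: "finsupp v1" "homogeneous (\<lambda>m i j. P m i j - witt_act a b m v1 i j)"
    "\<And>m i j. m > 0 \<Longrightarrow> i < 0 \<or> j < 0 \<Longrightarrow> P m i j - witt_act a b m v1 i j = 0"
    using witt_cocycle_to_quadrant[OF P ab] by blast
  define Q where "Q = (\<lambda>m i j. P m i j - witt_act a b m v1 i j)"
  have Q: "witt_cocycle a b Q" unfolding Q_def by (rule witt_cocycle_diff_coboundary[OF P v1(1)])
  have hom: "homogeneous Q"
    and low: "\<And>m i j. m > 0 \<Longrightarrow> i < 0 \<or> j < 0 \<Longrightarrow> Q m i j = 0"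
    unfolding Q_def using v1 by blast+
  have Qt: "witt_cocycle b a (\<lambda>m i j. Q m j i)" "homogeneous (\<lambda>m i j. Q m j i)"
    by (rule witt_cocycle_transpose[OF Q], rule homogeneous_transpose[OF hom])
  obtain c where c: "\<And>m. m > 0 \<Longrightarrow> Q m m 0 = c * of_int (a * m)"
    "Q (-1) 0 (-1) = - c * of_int b" "\<And>i j. i > 0 \<Longrightarrow> Q (-1) i j = 0"
    using quadrant_cocycle_boundary[OF Q hom ab low] by blast
  obtain d where d: "\<And>m. m > 0 \<Longrightarrow> Q m 0 m = d * of_int (b * m)"
    "Q (-1) (-1) 0 = - d * of_int a" "\<And>i j. j > 0 \<Longrightarrow> Q (-1) i j = 0"
    using quadrant_cocycle_boundary[OF Qt ab(2,1)] low by metis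
  define g where "g = Q 2 1 1"
  have E2: "of_int (1 - a) * g = of_int ((2 * b - 1) * b) * (d - c)"
  proof -
    have "witt_act a b 2 (Q (-1)) 0 1 = of_int ((2 * b - 1) * b) * c"
      using c d by (simp add: witt_act_def algebra_simps)
    moreover have "witt_act a b (-1) (Q 2) 0 1 = - of_int (1 - a) * g - of_int ((2 - b) * (2 * b)) * d"
      using d(1)[of 2] by (simp add: witt_act_def g_def algebra_simps)
    moreover have "Q 1 0 1 = d * of_int b" using d(1)[of 1] by simp
    ultimately show ?thesis
      using witt_cocycleD[OF Q, of 2 "-1" 0 1] by simp algebra
  qed
  have E3: "of_int (1 - b) * g = of_int ((2 * a - 1) * a) * (c - d)"
  proof -
    have "witt_act a b 2 (Q (-1)) 1 0 = of_int ((2 * a - 1) * a) * d"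
      using c d by (simp add: witt_act_def algebra_simps)
    moreover have "witt_act a b (-1) (Q 2) 1 0 = - of_int (1 - b) * g - of_int ((2 - a) * (2 * a)) * c"
      using c(1)[of 2] by (simp add: witt_act_def g_def algebra_simps)
    moreover have "Q 1 1 0 = c * of_int a" using c(1)[of 1] by simp
    ultimately show ?thesis
      using witt_cocycleD[OF Q, of 2 "-1" 1 0] by simp algebra
  qed
  \<comment> \<open>for \<open>(a, b) \<noteq> (1, 1)\<close> one eliminates \<open>g\<close> from the two equations; the coefficient that
    remains is a sum of two of the values 0, 6, -30, not both 0, hence nonzero\<close>
  have cd: "d = c"
  proof (cases "a = 1 \<and> b = 1")
    case True
    then show ?thesis using E2 by simp
  next
    case False
    have "of_int ((2 * b - 1) * b * (1 - b) + (2 * a - 1) * a * (1 - a)) * (d - c) = 0"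
      using E2 E3 by simp algebra
    moreover have "(of_int ((2 * b - 1) * b * (1 - b) + (2 * a - 1) * a * (1 - a)) :: complex) \<noteq> 0"
      by (rule of_int_nonzero) (use ab False in auto)
    ultimately show ?thesis by simp
  qed
  define w where "w = (\<lambda>i j. if i = (0::int) \<and> j = (0::int) then - c else 0)"
  have w: "finsupp w" unfolding w_def by (rule finsupp_delta)
  define R where "R = (\<lambda>m i j. Q m i j - witt_act a b m w i j)"
  have R: "witt_cocycle a b R" unfolding R_def by (rule witt_cocycle_diff_coboundary[OF Q w])
  have homR: "R m i j = 0" if "i + j \<noteq> m" for m i j
    using that hom by (auto simp: R_def w_def witt_act_def homogeneous_def)
  have lowR: "R m i j = 0" if mij: "m > 0" "i \<le> 0 \<or> j \<le> 0" for m i j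
  proof (cases "i + j = m")
    case True
    consider "i < 0 \<or> j < 0" | "i = 0" "j = m" | "i = m" "j = 0"
      using mij True by force
    then show ?thesis
    proof cases
      case 1
      then show ?thesis using that low[of m i j] True by (auto simp: R_def w_def witt_act_def)
    next
      case 2
      then show ?thesis using that d(1)[of m] by (simp add: R_def w_def witt_act_def cd)
    next
      case 3
      then show ?thesis using that c(1)[of m] by (simp add: R_def w_def witt_act_def)
    qed
  qed (rule homR)
  have R1: "R 1 i j = 0" for i j
    by (cases "i \<le> 0 \<or> j \<le> 0") (auto intro: lowR homR)
  have R2: "R 2 i j = 0" if "i \<noteq> 1 \<or> j \<noteq> 1" for i j
    using that by (cases "i \<le> 0 \<or> j \<le> 0") (auto intro: lowR homR)
  define v where "v = (\<lambda>i j. v1 i j + w i j)"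
  have v: "finsupp v" unfolding v_def by (rule finsupp_add[OF v1(1) w])
  have PR: "P m i j = witt_act a b m v i j + R m i j" for m i j
    unfolding v_def witt_act_add by (simp add: R_def Q_def)
  show ?thesis
  proof (cases "a = 1 \<and> b = 1")
    case False
    have "g = 0" using E2 E3 False by (auto simp: cd)
    then have "R 2 1 1 = 0" by (simp add: R_def g_def w_def witt_act_def)
    then have "R 2 i j = 0" for i j using R2[of i j] by (cases "i = 1 \<and> j = 1") auto
    then have "R m i j = 0" for m i j by (rule witt_cocycle_zeroI[OF R a0 R1])
    then show ?thesis using PR by (intro that[OF v]) simp
  next
    case True
    define S where "S = (\<lambda>m i j. R m i j - R m j i)"
    have S: "witt_cocycle a b S"
      unfolding S_def using witt_cocycle_diff[OF R] witt_cocycle_transpose[OF R] True by simp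
    have "S 1 i j = 0" "S 2 i j = 0" for i j
      using R1 R2[of i j] R2[of j i] by (cases "i = 1 \<and> j = 1"; auto simp: S_def)+
    then have S0: "S m i j = 0" for m i j by (rule witt_cocycle_zeroI[OF S a0])
    define u where "u = (\<lambda>i j. (1 / 2) * (v i j - v j i))"
    have "finsupp (\<lambda>i j. v i j - v j i)" by (rule finsupp_diff[OF v finsupp_transpose[OF v]])
    then have u: "finsupp u" by (rule finsupp_subset) (simp add: u_def)
    have "P m i j = witt_act a b m u i j" for m i j
    proof -
      have "witt_act a b m u i j = (1 / 2) * (witt_act a b m v i j - witt_act b a m v j i)"
        unfolding u_def witt_act_scale witt_act_diff witt_act_transpose[of a b m v] ..
      also have "\<dots> = (1 / 2) * (P m i j - P m j i - S m i j)"
        using True by (simp add: PR S_def)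
      also have "\<dots> = P m i j" using S0 skew[of m i j] True by simp
      finally show ?thesis by simp
    qed
    then show ?thesis by (rule that[OF u])
  qed
qed

section \<open>The Lie algebra as a module over its Witt subalgebra\<close>

fun index :: "gen \<Rightarrow> int" where
  "index (L n) = n" | "index (W n) = n" | "index (Z n) = n"

fun weight :: "gen \<Rightarrow> int" where
  "weight (L n) = - 1" | "weight (W n) = 1" | "weight (Z n) = 3"

fun shift :: "int \<Rightarrow> gen \<Rightarrow> gen" where
  "shift m (L n) = L (m + n)" | "shift m (W n) = W (m + n)" | "shift m (Z n) = Z (m + n)"

text \<open>
  One generator of each kind: the other ones are its shifts, and a pair of base generators selects one
  of the nine Witt submodules of the tensor square.
\<close>
definition "base_gens = {L 0, W 0, Z 0}"

lemma weight_cases: "weight g \<in> {-1, 1, 3}" by (cases g) auto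

lemma index_shift [simp]: "index (shift m g) = m + index g" by (cases g) auto
lemma weight_shift [simp]: "weight (shift m g) = weight g" by (cases g) auto
lemma shift_shift [simp]: "shift m (shift n g) = shift (m + n) g" by (cases g) auto
lemma shift_0 [simp]: "shift 0 g = g" by (cases g) auto
lemma shift_eq_iff: "shift m g = h \<longleftrightarrow> g = shift (- m) h" by (cases g; cases h) auto

lemma gen_bracket_L:
  "gen_bracket (L m) g = cscale (- of_int (index g + weight g * m)) (basis (shift m g))"
  by (cases g) (simp_all add: algebra_simps)

lemma gen_decompose: "shift (- index g) g \<in> base_gens" by (cases g) (auto simp: base_gens_def)

lemma index_base_gens: "t \<in> base_gens \<Longrightarrow> index t = 0" by (auto simp: base_gens_def)

lemma lookup_lin_ext_monomial:
  assumes f: "\<And>i. f i = cscale (c i) (basis (\<sigma> i))" and k: "\<And>i. \<sigma> i = k \<longleftrightarrow> i = pre"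
  shows "Poly_Mapping.lookup (lin_ext f p) k = c pre * Poly_Mapping.lookup p pre"
proof -
  have "Poly_Mapping.lookup (lin_ext f p) k
      = (\<Sum>i\<in>Poly_Mapping.keys p. if i = pre then c pre * Poly_Mapping.lookup p pre else 0)"
    unfolding lin_ext_to_def lookup_sum
    by (intro sum.cong) (auto simp: f lookup_single when_def k)
  then show ?thesis by (auto simp: in_keys_iff)
qed

lemma lookup_twist: "Poly_Mapping.lookup (twist v) (g, h) = Poly_Mapping.lookup v (h, g)"
proof -
  have "twist v = lin_ext (\<lambda>p. cscale 1 (basis (prod.swap p))) v"
    unfolding twist_def by (rule arg_cong[of _ _ "\<lambda>f. lin_ext f v"]) (auto simp: fun_eq_iff)
  moreover have "Poly_Mapping.lookup (lin_ext (\<lambda>p. cscale 1 (basis (prod.swap p))) v) (g, h)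
      = 1 * Poly_Mapping.lookup v (h, g)"
    by (rule lookup_lin_ext_monomial[where \<sigma> = prod.swap]) auto
  ultimately show ?thesis by simp
qed

lemma lookup_cyc: "Poly_Mapping.lookup (cyc v) (g, h, k) = Poly_Mapping.lookup v (k, g, h)"
proof -
  let ?s = "\<lambda>(i, j, k). (j, k, i)"
  have "cyc v = lin_ext (\<lambda>p. cscale 1 (basis (?s p))) v"
    unfolding cyc_def by (rule arg_cong[of _ _ "\<lambda>f. lin_ext f v"]) (auto simp: fun_eq_iff)
  moreover have "Poly_Mapping.lookup (lin_ext (\<lambda>p. cscale 1 (basis (?s p))) v) (g, h, k)
      = 1 * Poly_Mapping.lookup v (k, g, h)"
    by (rule lookup_lin_ext_monomial[where \<sigma> = ?s]) auto
  ultimately show ?thesis by simp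
qed

lemma tensor_cscale_left: "cscale c x \<otimes> y = cscale c (x \<otimes> y)"
  by (rule clinear_scale[OF clinear_tensor_left])

lemma tensor_cscale_right: "x \<otimes> cscale c y = cscale c (x \<otimes> y)"
  by (rule clinear_scale[OF clinear_tensor_right])

lemma lookup_L_first:
  "Poly_Mapping.lookup (tensor_map (bracket (basis (L m))) id v) (g, h)
     = - of_int (index g - m + weight g * m) * Poly_Mapping.lookup v (shift (- m) g, h)"
  unfolding tensor_map_def
  by (subst lookup_lin_ext_monomial[where
        c = "\<lambda>(i, j). - of_int (index i + weight i * m)" and \<sigma> = "\<lambda>(i, j). (shift m i, j)"
        and pre = "(shift (- m) g, h)"])
    (auto simp: gen_bracket_L tensor_cscale_left shift_eq_iff)

lemma lookup_L_second:
  "Poly_Mapping.lookup (tensor_map id (bracket (basis (L m))) v) (g, h)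
     = - of_int (index h - m + weight h * m) * Poly_Mapping.lookup v (g, shift (- m) h)"
  unfolding tensor_map_def
  by (subst lookup_lin_ext_monomial[where
        c = "\<lambda>(i, j). - of_int (index j + weight j * m)" and \<sigma> = "\<lambda>(i, j). (i, shift m j)"
        and pre = "(g, shift (- m) h)"])
    (auto simp: gen_bracket_L tensor_cscale_right shift_eq_iff)

definition coeffs :: "gen \<Rightarrow> gen \<Rightarrow> (gen \<times> gen) cvec \<Rightarrow> int \<Rightarrow> int \<Rightarrow> complex" where
  "coeffs t u v i j = Poly_Mapping.lookup v (shift i t, shift j u)"

lemma coeffs_adj_act_L:
  assumes "t \<in> base_gens" "u \<in> base_gens"
  shows "coeffs t u (adj_act bracket (basis (L m)) v) = witt_act (weight t) (weight u) m (coeffs t u v)"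
  using assms[THEN index_base_gens]
  by (auto simp: fun_eq_iff coeffs_def adj_act_def lookup_add lookup_L_first lookup_L_second witt_act_def
      algebra_simps)

lemma finsupp_coeffs: "finsupp (coeffs t u v)"
proof -
  have "(\<lambda>(i, j). (shift i t, shift j u)) ` {(i, j). coeffs t u v i j \<noteq> 0} \<subseteq> Poly_Mapping.keys v"
    by (auto simp: coeffs_def in_keys_iff)
  moreover have "inj (\<lambda>(i, j). (shift i t, shift j u))"
    by (cases t; cases u) (auto intro!: injI)
  ultimately show ?thesis
    unfolding finsupp_def by (meson finite_keys finite_subset finite_imageD inj_on_subset subset_UNIV)
qed

lemma coeffs_eqI:
  assumes "\<And>t u. t \<in> base_gens \<Longrightarrow> u \<in> base_gens \<Longrightarrow> coeffs t u v = coeffs t u w"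
  shows "v = w"
proof (rule poly_mapping_eqI)
  fix k show "Poly_Mapping.lookup v k = Poly_Mapping.lookup w k"
  proof (cases k)
    case (Pair g h)
    have "coeffs (shift (- index g) g) (shift (- index h) h) v (index g) (index h)
        = coeffs (shift (- index g) g) (shift (- index h) h) w (index g) (index h)"
      using assms[OF gen_decompose gen_decompose] by simp
    then show ?thesis by (simp add: coeffs_def Pair)
  qed
qed

text \<open>
  The tensor square is the direct sum of its nine Witt submodules, so that the tensor \<open>r\<close> can be
  sought in each of them separately.
\<close>
lemma coeffs_surj:
  assumes "\<And>t u. t \<in> base_gens \<Longrightarrow> u \<in> base_gens \<Longrightarrow> finsupp (v t u)"
  obtains r where "\<And>t u. t \<in> base_gens \<Longrightarrow> u \<in> base_gens \<Longrightarrow> coeffs t u r = v t u"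
proof -
  define F where "F = (\<lambda>(g, h). v (shift (- index g) g) (shift (- index h) h) (index g) (index h))"
  have "{k. F k \<noteq> 0} \<subseteq> (\<Union>t\<in>base_gens. \<Union>u\<in>base_gens.
      (\<lambda>(i, j). (shift i t, shift j u)) ` {(i, j). v t u i j \<noteq> 0})"
  proof clarify
    fix g h assume "F (g, h) \<noteq> 0"
    then have "v (shift (- index g) g) (shift (- index h) h) (index g) (index h) \<noteq> 0"
      by (simp add: F_def)
    then show "(g, h) \<in> (\<Union>t\<in>base_gens. \<Union>u\<in>base_gens.
      (\<lambda>(i, j). (shift i t, shift j u)) ` {(i, j). v t u i j \<noteq> 0})"
      by (intro UN_I[OF gen_decompose[of g]] UN_I[OF gen_decompose[of h]]
          image_eqI[of _ _ "(index g, index h)"]) auto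
  qed
  moreover have "finite (\<Union>t\<in>base_gens. \<Union>u\<in>base_gens.
      (\<lambda>(i, j). (shift i t, shift j u)) ` {(i, j). v t u i j \<noteq> 0})"
    using assms by (intro finite_UN_I finite_imageI) (auto simp: base_gens_def finsupp_def)
  ultimately have fin: "finite {k. F k \<noteq> 0}" by (rule finite_subset)
  then have F: "Poly_Mapping.lookup (Abs_poly_mapping F) = F"
    by (intro Abs_poly_mapping_inverse) simp
  show ?thesis
  proof (rule that[of "Abs_poly_mapping F"])
    fix t u assume "t \<in> base_gens" "u \<in> base_gens"
    then show "coeffs t u (Abs_poly_mapping F) = v t u"
      unfolding fun_eq_iff coeffs_def F by (simp add: F_def index_base_gens)
  qed
qed

section \<open>Derivations into the tensor square are inner\<close>

definition tensor_derivation :: "('b cvec \<Rightarrow> 'b cvec \<Rightarrow> 'b cvec)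
    \<Rightarrow> ('b cvec \<Rightarrow> ('b \<times> 'b) cvec) \<Rightarrow> bool" where
  "tensor_derivation br D \<longleftrightarrow> clinear D \<and>
     (\<forall>x y. D (br x y) = adj_act br x (D y) - adj_act br y (D x))"

lemma clinear_adj_act: "clinear (adj_act br x)"
  unfolding adj_act_def by (intro clinear_plus clinear_tensor_map)

lemma clinear_adj_act_left:
  assumes "lie_algebra br" shows "clinear (\<lambda>x. adj_act br x t)"
proof (rule clinearI)
  have br2: "clinear (\<lambda>x. br x y)" for y using assms by (auto simp: lie_algebra_def)
  note simps = adj_act_tensor[OF assms] clinear_add[OF br2] clinear_scale[OF br2]
    clinear_add[OF clinear_tensor_left] clinear_add[OF clinear_tensor_right]
    tensor_cscale_left tensor_cscale_right cvec.scale_right_distrib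
  fix x y show "adj_act br (x + y) t = adj_act br x t + adj_act br y t"
  proof (rule linear_eq_on_basis[OF clinear_adj_act clinear_plus[OF clinear_adj_act clinear_adj_act]])
    fix k :: "'a \<times> 'a"
    obtain i j where k: "basis k = basis i \<otimes> basis j" by (cases k) simp
    show "adj_act br (x + y) (basis k) = adj_act br x (basis k) + adj_act br y (basis k)"
      unfolding k simps by simp
  qed
next
  have br2: "clinear (\<lambda>x. br x y)" for y using assms by (auto simp: lie_algebra_def)
  note simps = adj_act_tensor[OF assms] clinear_add[OF br2] clinear_scale[OF br2]
    clinear_add[OF clinear_tensor_left] clinear_add[OF clinear_tensor_right]
    tensor_cscale_left tensor_cscale_right cvec.scale_right_distrib
  have sc: "clinear (\<lambda>t. cscale c (adj_act br x t))" for c x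
    by (rule clinearI)
      (simp_all add: clinear_add[OF clinear_adj_act] clinear_scale[OF clinear_adj_act]
        cvec.scale_right_distrib mult.commute)
  fix c x show "adj_act br (cscale c x) t = cscale c (adj_act br x t)"
  proof (rule linear_eq_on_basis[OF clinear_adj_act sc])
    fix k :: "'a \<times> 'a"
    obtain i j where k: "basis k = basis i \<otimes> basis j" by (cases k) simp
    show "adj_act br (cscale c x) (basis k) = cscale c (adj_act br x (basis k))"
      unfolding k simps ..
  qed
qed

lemma lie_bracket_antisym:
  assumes "lie_algebra br" shows "br x y = - br y x"
proof -
  have br: "clinear (br x)" "clinear (\<lambda>x. br x y)" "br x x = 0" for x y
    using assms by (auto simp: lie_algebra_def)
  have "br (x + y) (x + y) = 0" by (rule br(3))
  then show ?thesis
    unfolding clinear_add[OF br(1)] clinear_add[OF br(2)] by (simp add: br(3) add_eq_0_iff)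
qed

lemma lie_bracket_commutator:
  assumes "lie_algebra br" shows "br (br x y) z = br x (br y z) - br y (br x z)"
proof -
  have br1: "clinear (br x)" for x using assms by (auto simp: lie_algebra_def)
  have "br x (br y z) + br y (br z x) + br z (br x y) = 0" using assms by (auto simp: lie_algebra_def)
  moreover have "br y (br z x) = - br y (br x z)"
    by (subst lie_bracket_antisym[OF assms, of z x]) (rule clinear_neg[OF br1])
  moreover have "br z (br x y) = - br (br x y) z" by (rule lie_bracket_antisym[OF assms])
  ultimately show ?thesis by (simp add: algebra_simps)
qed

lemma adj_act_commutator:
  assumes br: "lie_algebra br"
  shows "adj_act br (br x y) t = adj_act br x (adj_act br y t) - adj_act br y (adj_act br x t)"
proof -
  have "clinear (\<lambda>t. adj_act br x (adj_act br y t) + - adj_act br y (adj_act br x t))"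
    by (intro clinear_plus clinear_uminus clinear_comp[OF clinear_adj_act clinear_adj_act])
  then have "clinear (\<lambda>t. adj_act br x (adj_act br y t) - adj_act br y (adj_act br x t))" by simp
  then show ?thesis
  proof (rule linear_eq_on_basis[OF clinear_adj_act])
    fix k :: "'a \<times> 'a"
    obtain i j where k: "basis k = basis i \<otimes> basis j" by (cases k) simp
    have sub: "(u - v) \<otimes> w = u \<otimes> w - v \<otimes> w" "w \<otimes> (u - v) = w \<otimes> u - w \<otimes> v" for u v w :: "'a cvec"
      using clinear_add[OF clinear_tensor_left, of u "- v" w] clinear_neg[OF clinear_tensor_left, of v w]
        clinear_add[OF clinear_tensor_right, of w u "- v"] clinear_neg[OF clinear_tensor_right, of w v]
      by simp_all
    show "adj_act br (br x y) (basis k)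
        = adj_act br x (adj_act br y (basis k)) - adj_act br y (adj_act br x (basis k))"
      unfolding k adj_act_tensor[OF br] clinear_add[OF clinear_adj_act] lie_bracket_commutator[OF br] sub
      by simp
  qed
qed

lemma tensor_derivation_diff_inner:
  assumes br: "lie_algebra br" and D: "tensor_derivation br D"
  shows "tensor_derivation br (\<lambda>x. D x - adj_act br x r)"
proof -
  have "clinear (\<lambda>x. D x + - adj_act br x r)"
    using D by (intro clinear_plus clinear_uminus clinear_adj_act_left[OF br])
      (simp add: tensor_derivation_def)
  moreover have "adj_act br x (u - v) = adj_act br x u - adj_act br x v" for x u v
    using clinear_add[OF clinear_adj_act, of br x u "- v"] clinear_neg[OF clinear_adj_act, of br x v] by simp
  ultimately show ?thesis
    using D by (simp add: tensor_derivation_def adj_act_commutator[OF br])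
qed

text \<open>
  Skew-symmetry enters only for the submodule spanned by the \<open>W i \<otimes> W j\<close>, the case in which both
  weights are 1.
\<close>
lemma tensor_derivation_inner_on_Witt:
  assumes D: "tensor_derivation bracket D" and skew: "\<And>x. twist (D x) = - D x"
  obtains r where "\<And>m. D (basis (L m)) = adj_act bracket (basis (L m)) r"
proof -
  have lin: "clinear D" and der: "D (bracket x y) = adj_act bracket x (D y) - adj_act bracket y (D x)" for x y
    using D by (auto simp: tensor_derivation_def)
  have cocycle: "witt_cocycle (weight t) (weight u) (\<lambda>m. coeffs t u (D (basis (L m))))"
    if tu: "t \<in> base_gens" "u \<in> base_gens" for t u
    unfolding witt_cocycle_def
  proof (intro conjI allI)
    show "finsupp (coeffs t u (D (basis (L m))))" for m by (rule finsupp_coeffs)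
    fix m n i j
    have "cscale (of_int (m - n)) (D (basis (L (m + n)))) = D (bracket (basis (L m)) (basis (L n)))"
      by (simp add: clinear_scale[OF lin])
    also have "\<dots> = adj_act bracket (basis (L m)) (D (basis (L n))) - adj_act bracket (basis (L n)) (D (basis (L m)))"
      by (rule der)
    finally have "coeffs t u (cscale (of_int (m - n)) (D (basis (L (m + n))))) i j
      = coeffs t u (adj_act bracket (basis (L m)) (D (basis (L n)))) i j
      - coeffs t u (adj_act bracket (basis (L n)) (D (basis (L m)))) i j"
      by (simp add: coeffs_def lookup_minus)
    then show "of_int (m - n) * coeffs t u (D (basis (L (m + n)))) i j
      = witt_act (weight t) (weight u) m (coeffs t u (D (basis (L n)))) i j
      - witt_act (weight t) (weight u) n (coeffs t u (D (basis (L m)))) i j"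
      unfolding coeffs_adj_act_L[OF tu] by (simp add: coeffs_def)
  qed
  have "\<exists>v. finsupp v \<and> (\<forall>m. coeffs t u (D (basis (L m))) = witt_act (weight t) (weight u) m v)"
    if tu: "t \<in> base_gens" "u \<in> base_gens" for t u
  proof (rule witt_cocycle_is_coboundary[OF cocycle[OF tu] weight_cases weight_cases])
    fix m i j assume "weight t = 1" "weight u = 1"
    then have W: "t = W 0" "u = W 0" using tu by (auto simp: base_gens_def)
    have "Poly_Mapping.lookup (twist (D (basis (L m)))) (W i, W j)
        = Poly_Mapping.lookup (- D (basis (L m))) (W i, W j)" by (simp only: skew)
    then show "coeffs t u (D (basis (L m))) j i = - coeffs t u (D (basis (L m))) i j"
      by (simp add: coeffs_def W lookup_twist)
  next
    fix v assume "finsupp v"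
      "\<And>m i j. coeffs t u (D (basis (L m))) i j = witt_act (weight t) (weight u) m v i j"
    then show ?thesis by (intro exI[of _ v]) (auto simp: fun_eq_iff)
  qed
  then obtain v where v: "\<And>t u. t \<in> base_gens \<Longrightarrow> u \<in> base_gens \<Longrightarrow> finsupp (v t u)"
    "\<And>t u m. t \<in> base_gens \<Longrightarrow> u \<in> base_gens \<Longrightarrow>
       coeffs t u (D (basis (L m))) = witt_act (weight t) (weight u) m (v t u)"
    by metis
  obtain r where r: "\<And>t u. t \<in> base_gens \<Longrightarrow> u \<in> base_gens \<Longrightarrow> coeffs t u r = v t u"
    using coeffs_surj[of v] v(1) by blast
  show ?thesis
    by (rule that[of r], rule coeffs_eqI) (simp add: coeffs_adj_act_L v(2) r)
qed

text \<open>
  For large \<open>m\<close> the entry at \<open>(i + m, j - m)\<close> only receives the contribution in which \<open>L m\<close> acts on the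
  first and \<open>L (- m)\<close> on the second factor.
\<close>
lemma witt_act_opposite_injective:
  assumes a: "a \<noteq> 0" and b: "b \<noteq> 0" and v: "finsupp v"
    and 0: "\<And>m i j. m > 0 \<Longrightarrow> witt_act a b m (witt_act a b (- m) v) i j = 0"
  shows "v i j = 0"
proof -
  obtain K where K: "\<And>i j. v i j \<noteq> 0 \<Longrightarrow> \<bar>i\<bar> < K \<and> \<bar>j\<bar> < K"
    using finsupp_bound[OF v] by blast
  define m where "m = \<bar>K\<bar> + \<bar>i\<bar> + \<bar>j\<bar> + 1"
  have m0: "m > 0" by (simp add: m_def)
  have small: "v (i + m) h = 0" "v (i + m + m) h = 0" for h
    using K[of "i + m" h] K[of "i + m + m" h] unfolding m_def by (smt (verit))+
  have nz: "i + a * m \<noteq> 0" "j - b * m \<noteq> 0"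
  proof -
    have *: "\<bar>c * m\<bar> \<ge> m" if "c \<noteq> 0" for c
    proof -
      have "1 * \<bar>m\<bar> \<le> \<bar>c\<bar> * \<bar>m\<bar>" using that by (intro mult_right_mono) auto
      then show ?thesis by (simp add: abs_mult)
    qed
    have "m > \<bar>i\<bar>" "m > \<bar>j\<bar>" by (simp_all add: m_def)
    then show "i + a * m \<noteq> 0" "j - b * m \<noteq> 0" using *[OF a] *[OF b] by linarith+
  qed
  have "witt_act a b (- m) v i (j - m) = - of_int (j - b * m) * v i j"
    "witt_act a b (- m) v (i + m) (j - m - m) = 0"
    using small by (simp_all add: witt_act_def) (simp add: algebra_simps)
  then have "witt_act a b m (witt_act a b (- m) v) (i + m) (j - m)
      = of_int ((i + a * m) * (j - b * m)) * v i j"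
    by (simp add: witt_act_def[of a b m]) (simp add: algebra_simps)
  then have "of_int ((i + a * m) * (j - b * m)) * v i j = 0"
    using 0[OF m0, of "i + m" "j - m"] by (simp only:)
  moreover have "(of_int ((i + a * m) * (j - b * m)) :: complex) \<noteq> 0"
    by (rule of_int_nonzero) (use nz in simp)
  ultimately show ?thesis by simp
qed

lemma weight_nonzero: "weight g \<noteq> 0" by (cases g) auto

text \<open>
  The value at \<open>W 0\<close> has to be treated first, because \<open>[L m, W (- m)] = 0\<close>: no bracket contains \<open>W 0\<close>,
  so its value cannot be computed from those at other generators.
\<close>
lemma tensor_derivation_zero:
  assumes D: "tensor_derivation bracket D" and L: "\<And>m. D (basis (L m)) = 0"
  shows "D x = 0"
proof -
  have lin: "clinear D" and der: "D (bracket x y) = adj_act bracket x (D y) - adj_act bracket y (D x)" for x y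
    using D by (auto simp: tensor_derivation_def)
  have act0: "adj_act bracket x 0 = 0" for x by (rule clinear_zero[OF clinear_adj_act])
  have LW: "adj_act bracket (basis (L m)) (D (basis (W n))) = cscale (- of_int (m + n)) (D (basis (W (m + n))))"
    for m n
  proof -
    have "D (bracket (basis (L m)) (basis (W n))) = cscale (- of_int (m + n)) (D (basis (W (m + n))))"
      by (simp add: clinear_scale[OF lin])
    then show ?thesis unfolding der by (simp add: L act0)
  qed
  have "adj_act bracket (basis (L m)) (adj_act bracket (basis (L (- m))) (D (basis (W 0)))) = 0" for m
    unfolding LW clinear_scale[OF clinear_adj_act] by simp
  then have 0: "witt_act (weight t) (weight u) m (witt_act (weight t) (weight u) (- m) (coeffs t u (D (basis (W 0))))) i j = 0"
    if "t \<in> base_gens" "u \<in> base_gens" for t u m i j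
    unfolding coeffs_adj_act_L[OF that, symmetric] by (simp add: coeffs_def)
  have W0: "D (basis (W 0)) = 0"
  proof (rule coeffs_eqI)
    fix t u assume tu: "t \<in> base_gens" "u \<in> base_gens"
    have "coeffs t u (D (basis (W 0))) i j = 0" for i j
      by (rule witt_act_opposite_injective[OF weight_nonzero weight_nonzero finsupp_coeffs 0[OF tu]])
    then show "coeffs t u (D (basis (W 0))) = coeffs t u 0" by (simp add: fun_eq_iff coeffs_def)
  qed
  have W: "D (basis (W n)) = 0" for n
  proof (cases "n = 0")
    case False
    have "cscale (- of_int n) (D (basis (W n))) = 0" using LW[of n 0] by (simp add: W0 act0)
    then show ?thesis using False by (simp only: cvec.scale_eq_0_iff) simp
  qed (simp add: W0)
  have Z: "D (basis (Z n)) = 0" for n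
  proof -
    have WW: "cscale (of_int (k - l)) (D (basis (Z (k + l)))) = 0" for k l
    proof -
      have "cscale (of_int (k - l)) (D (basis (Z (k + l)))) = D (bracket (basis (W k)) (basis (W l)))"
        by (simp add: clinear_scale[OF lin])
      also have "\<dots> = 0" unfolding der by (simp add: W act0)
      finally show ?thesis .
    qed
    show ?thesis
    proof (cases "n = 0")
      case True
      then show ?thesis using WW[of 1 "- 1"] by (simp only: cvec.scale_eq_0_iff) simp
    next
      case False
      then show ?thesis using WW[of n 0] by (simp only: cvec.scale_eq_0_iff) simp
    qed
  qed
  have "D (basis g) = 0" for g by (cases g) (simp_all add: L W Z)
  then show ?thesis by (rule linear_eq_on_basis[OF lin clinear_zero_map])
qed

lemma skew_tensors_iff: "t \<in> skew_tensors \<longleftrightarrow> twist t = - t"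
proof
  assume "t \<in> skew_tensors"
  then show "twist t = - t"
    by (auto simp: skew_tensors_def intro!: poly_mapping_eqI simp: lookup_twist lookup_minus)
next
  assume *: "twist t = - t"
  let ?h = "cscale (1 / 2) t"
  have "twist ?h = - ?h" by (simp add: clinear_scale[OF clinear_twist] *)
  then have "?h - twist ?h = ?h + ?h" by simp
  also have "\<dots> = t" by (rule poly_mapping_eqI) (simp add: lookup_add)
  finally show "t \<in> skew_tensors" unfolding skew_tensors_def by (metis rangeI)
qed

lemma twist_adj_act:
  assumes br: "lie_algebra br" shows "twist (adj_act br x t) = adj_act br x (twist t)"
proof (rule linear_eq_on_basis[OF clinear_comp[OF clinear_twist clinear_adj_act]
      clinear_comp[OF clinear_adj_act clinear_twist]])
  fix k :: "'a \<times> 'a"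
  obtain i j where k: "basis k = basis i \<otimes> basis j" by (cases k) simp
  show "twist (adj_act br x (basis k)) = adj_act br x (twist (basis k))"
    unfolding k adj_act_tensor[OF br] twist_tensor clinear_add[OF clinear_twist] by simp
qed

text \<open>
  An \<open>r\<close> with \<open>D x = x \<cdot> r\<close> need not be skew-symmetric itself.  As the twist commutes with the action
  and changes the sign of \<open>D x\<close>, the skew-symmetric part of \<open>r\<close> defines the same derivation.
\<close>
theorem tensor_derivation_inner:
  assumes D: "tensor_derivation bracket D" and skew: "range D \<subseteq> skew_tensors"
  obtains r where "r \<in> skew_tensors" "\<And>x. D x = adj_act bracket x r"
proof -
  have sk: "twist (D x) = - D x" for x using skew by (auto simp: skew_tensors_iff[symmetric])
  obtain r where r: "\<And>m. D (basis (L m)) = adj_act bracket (basis (L m)) r"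
    using tensor_derivation_inner_on_Witt[OF D sk] by blast
  have "D x - adj_act bracket x r = 0" for x
    by (rule tensor_derivation_zero[OF tensor_derivation_diff_inner[OF lie_algebra_bracket D]])
      (simp add: r)
  then have Dr: "D x = adj_act bracket x r" for x by simp
  let ?s = "cscale (1 / 2) (r - twist r)"
  have "twist ?s = - ?s"
    by (rule poly_mapping_eqI)
      (simp only: split_paired_all, simp add: lookup_twist lookup_minus algebra_simps)
  moreover have "D x = adj_act bracket x ?s" for x
  proof -
    have "adj_act bracket x ?s = cscale (1 / 2) (adj_act bracket x r + - adj_act bracket x (twist r))"
      using clinear_add[OF clinear_adj_act, of bracket x r "- twist r"]
      by (simp add: clinear_scale[OF clinear_adj_act] clinear_neg[OF clinear_adj_act])
    also have "\<dots> = cscale (1 / 2) (D x + - twist (D x))"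
      by (simp add: Dr twist_adj_act[OF lie_algebra_bracket])
    also have "\<dots> = D x" by (rule poly_mapping_eqI) (simp add: sk lookup_add)
    finally show ?thesis by simp
  qed
  ultimately show ?thesis by (intro that[of ?s]) (simp_all add: skew_tensors_iff)
qed

section \<open>The classical Yang--Baxter equation\<close>

lemma skew_swap:
  assumes r: "r = (\<Sum>k\<in>I. a k \<otimes> b k)" and skew: "twist r = - r"
    and f: "\<And>v. clinear (\<lambda>u. f u v)" "\<And>u. clinear (f u)"
  shows "(\<Sum>k\<in>I. f (a k) (b k)) = - (\<Sum>k\<in>I. f (b k) (a k))"
proof -
  obtain g where g: "clinear g" "\<And>x y. g (x \<otimes> y) = f x y" using tensor_universal[OF f] by blast
  have "(\<Sum>k\<in>I. f (b k) (a k)) = g (twist r)"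
    by (simp add: r clinear_sum[OF clinear_twist] clinear_sum[OF g(1)] twist_tensor g(2))
  also have "\<dots> = - g r" by (simp add: skew clinear_neg[OF g(1)])
  also have "g r = (\<Sum>k\<in>I. f (a k) (b k))" by (simp add: r clinear_sum[OF g(1)] g(2))
  finally show ?thesis by simp
qed

lemma cyc_cyc_cyc: "cyc (cyc (cyc t)) = t"
  by (rule poly_mapping_eqI) (auto simp: lookup_cyc split: prod.splits)

text \<open>
  Apply \<open>(1 \<otimes> \<Delta>) \<Delta>\<close> to \<open>x\<close> and sort the terms by the factor \<open>T1\<close>, \<open>T2\<close>, \<open>T3\<close> on which \<open>x\<close> acts.
  Rotating each of them so that \<open>x\<close> acts on the first factor gives \<open>T1 + \<xi> T2 + \<xi>\<^sup>2 T3\<close>, and the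
  cyclic sum is insensitive to these rotations because \<open>\<xi>\<^sup>3 = 1\<close>.  By the skew-symmetry of
  \<open>r = \<Sum> a i \<otimes> b i\<close>, the last two terms are sums of \<open>[[x, a i], a j] \<otimes> b i \<otimes> b j\<close> and
  \<open>- [[x, a j], a i] \<otimes> b i \<otimes> b j\<close>, which the Jacobi identity combines to
  \<open>[x, [a i, a j]] \<otimes> b i \<otimes> b j\<close>, the first part of \<open>x\<close> acting on \<open>c(r)\<close>.
\<close>
lemma coJacobi_coboundary:
  assumes br: "lie_algebra br" and skew: "twist r = - r"
  defines "t \<equiv> \<lambda>x. tensor_map id (\<lambda>y. adj_act br y r) (adj_act br x r)"
    and "s \<equiv> \<lambda>x. tensor_map (br x) id (cyb br r)"
  shows "t x + cyc (t x) + cyc (cyc (t x)) = s x + cyc (s x) + cyc (cyc (s x))"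
proof -
  define I where "I = Poly_Mapping.keys r"
  define a where "a = (\<lambda>k. cscale (Poly_Mapping.lookup r k) (basis (fst k)))"
  define b where "b = (\<lambda>k::'a \<times> 'a. basis (snd k) :: 'a cvec)"
  have r: "r = (\<Sum>k\<in>I. a k \<otimes> b k)"
    by (subst basis_expansion) (simp add: I_def a_def b_def tensor_cscale_left)
  have br1: "clinear (br x)" and br2: "clinear (\<lambda>x. br x y)" for x y
    using br by (auto simp: lie_algebra_def)
  have act: "adj_act br y r = (\<Sum>j\<in>I. br y (a j) \<otimes> b j + a j \<otimes> br y (b j))" for y
    by (subst r) (simp add: clinear_sum[OF clinear_adj_act] adj_act_tensor[OF br])
  note lin_act = clinear_adj_act_left[OF br]
  define T1 where "T1 = (\<Sum>i\<in>I. \<Sum>j\<in>I. br x (a i) \<otimes> br (b i) (a j) \<otimes> b j + br x (a i) \<otimes> a j \<otimes> br (b i) (b j))"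
  define T2 where "T2 = (\<Sum>i\<in>I. \<Sum>j\<in>I. a i \<otimes> br (br x (b i)) (a j) \<otimes> b j)"
  define T3 where "T3 = (\<Sum>i\<in>I. \<Sum>j\<in>I. a i \<otimes> a j \<otimes> br (br x (b i)) (b j))"
  have t: "t x = T1 + T2 + T3"
  proof -
    have "t x = (\<Sum>i\<in>I. br x (a i) \<otimes> adj_act br (b i) r + a i \<otimes> adj_act br (br x (b i)) r)"
      unfolding t_def act[of x] clinear_sum[OF clinear_tensor_map] clinear_add[OF clinear_tensor_map]
        tensor_map_tensor[OF clinear_id(2) lin_act] id_apply ..
    also have "\<dots> = T1 + T2 + T3"
      unfolding act clinear_sum[OF clinear_tensor_right] clinear_add[OF clinear_tensor_right]
        T1_def T2_def T3_def sum.distrib by (simp add: add.assoc)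
    finally show ?thesis .
  qed
  have c2: "cyc T2 = (\<Sum>i\<in>I. \<Sum>j\<in>I. br (br x (b i)) (a j) \<otimes> b j \<otimes> a i)"
    unfolding T2_def clinear_sum[OF clinear_cyc] cyc_tensor ..
  have c3: "cyc (cyc T3) = (\<Sum>i\<in>I. \<Sum>j\<in>I. br (br x (b i)) (b j) \<otimes> a i \<otimes> a j)"
    unfolding T3_def clinear_sum[OF clinear_cyc] cyc_tensor ..
  have c2': "cyc T2 = - (\<Sum>i\<in>I. \<Sum>j\<in>I. br (br x (a j)) (a i) \<otimes> b i \<otimes> b j)"
  proof -
    have "cyc T2 = (\<Sum>j\<in>I. \<Sum>i\<in>I. br (br x (b i)) (a j) \<otimes> b j \<otimes> a i)"
      unfolding c2 by (rule sum.swap)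
    also have "\<dots> = (\<Sum>j\<in>I. - (\<Sum>i\<in>I. br (br x (a i)) (a j) \<otimes> b j \<otimes> b i))"
    proof (rule sum.cong[OF refl])
      fix j
      have "(\<Sum>i\<in>I. br (br x (a i)) (a j) \<otimes> b j \<otimes> b i)
          = - (\<Sum>i\<in>I. br (br x (b i)) (a j) \<otimes> b j \<otimes> a i)"
        by (rule skew_swap[OF r skew, where f = "\<lambda>u v. br (br x u) (a j) \<otimes> b j \<otimes> v"])
          (intro clinear_comp[OF clinear_tensor_left clinear_comp[OF br2 br1]]
            clinear_comp[OF clinear_tensor_right clinear_tensor_right])+
      then show "(\<Sum>i\<in>I. br (br x (b i)) (a j) \<otimes> b j \<otimes> a i)
          = - (\<Sum>i\<in>I. br (br x (a i)) (a j) \<otimes> b j \<otimes> b i)" by simp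
    qed
    finally show ?thesis by (simp add: sum_negf)
  qed
  have c3': "cyc (cyc T3) = (\<Sum>i\<in>I. \<Sum>j\<in>I. br (br x (a i)) (a j) \<otimes> b i \<otimes> b j)"
  proof -
    have "cyc (cyc T3) = (\<Sum>j\<in>I. \<Sum>i\<in>I. br (br x (b i)) (b j) \<otimes> a i \<otimes> a j)"
      unfolding c3 by (rule sum.swap)
    also have "\<dots> = (\<Sum>j\<in>I. - (\<Sum>i\<in>I. br (br x (a i)) (b j) \<otimes> b i \<otimes> a j))"
    proof (rule sum.cong[OF refl])
      fix j
      have "(\<Sum>i\<in>I. br (br x (a i)) (b j) \<otimes> b i \<otimes> a j)
          = - (\<Sum>i\<in>I. br (br x (b i)) (b j) \<otimes> a i \<otimes> a j)"
        by (rule skew_swap[OF r skew, where f = "\<lambda>u v. br (br x u) (b j) \<otimes> v \<otimes> a j"])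
          (intro clinear_comp[OF clinear_tensor_left clinear_comp[OF br2 br1]]
            clinear_comp[OF clinear_tensor_right clinear_tensor_left])+
      then show "(\<Sum>i\<in>I. br (br x (b i)) (b j) \<otimes> a i \<otimes> a j)
          = - (\<Sum>i\<in>I. br (br x (a i)) (b j) \<otimes> b i \<otimes> a j)" by simp
    qed
    also have "\<dots> = - (\<Sum>j\<in>I. \<Sum>i\<in>I. br (br x (a i)) (b j) \<otimes> b i \<otimes> a j)"
      by (rule sum_negf)
    also have "\<dots> = - (\<Sum>i\<in>I. \<Sum>j\<in>I. br (br x (a i)) (b j) \<otimes> b i \<otimes> a j)"
      by (subst sum.swap) (rule refl)
    also have "\<dots> = - (\<Sum>i\<in>I. - (\<Sum>j\<in>I. br (br x (a i)) (a j) \<otimes> b i \<otimes> b j))"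
    proof (intro arg_cong[of _ _ uminus] sum.cong[OF refl])
      fix i
      have "(\<Sum>j\<in>I. br (br x (a i)) (a j) \<otimes> b i \<otimes> b j)
          = - (\<Sum>j\<in>I. br (br x (a i)) (b j) \<otimes> b i \<otimes> a j)"
        by (rule skew_swap[OF r skew, where f = "\<lambda>u v. br (br x (a i)) u \<otimes> b i \<otimes> v"])
          (intro clinear_comp[OF clinear_tensor_left br1]
            clinear_comp[OF clinear_tensor_right clinear_tensor_right])+
      then show "(\<Sum>j\<in>I. br (br x (a i)) (b j) \<otimes> b i \<otimes> a j)
          = - (\<Sum>j\<in>I. br (br x (a i)) (a j) \<otimes> b i \<otimes> b j)" by simp
    qed
    finally show ?thesis by (simp add: sum_negf)
  qed
  have s: "s x = T1 + cyc T2 + cyc (cyc T3)"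
  proof -
    have sub: "(u - v) \<otimes> w = u \<otimes> w - v \<otimes> w" for u v :: "'a cvec" and w :: "('a \<times> 'a) cvec"
      using clinear_add[OF clinear_tensor_left, of u "- v" w] clinear_neg[OF clinear_tensor_left, of v w]
      by simp
    have jac: "br x (br u v) = br (br x u) v - br (br x v) u" for u v
      using lie_bracket_commutator[OF br, of x u v] lie_bracket_antisym[OF br, of "br x v" u]
      by simp
    have "s x = (\<Sum>i\<in>I. \<Sum>j\<in>I. br x (br (a i) (a j)) \<otimes> b i \<otimes> b j)
        + (\<Sum>i\<in>I. \<Sum>j\<in>I. br x (a i) \<otimes> br (b i) (a j) \<otimes> b j)
        + (\<Sum>i\<in>I. \<Sum>j\<in>I. br x (a i) \<otimes> a j \<otimes> br (b i) (b j))"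
      unfolding s_def cyb_sum[OF br r] clinear_add[OF clinear_tensor_map]
        clinear_sum[OF clinear_tensor_map] tensor_map_tensor[OF br1 clinear_id(2)] id_apply ..
    also have "\<dots> = T1 + cyc T2 + cyc (cyc T3)"
      unfolding c2' c3' T1_def jac sub sum_subtractf sum.distrib by simp
    finally show ?thesis .
  qed
  show ?thesis unfolding s t clinear_add[OF clinear_cyc] cyc_cyc_cyc by (simp add: algebra_simps)
qed

text \<open>
  For large \<open>m\<close>, an entry whose first index is large and whose other indices are bounded can only
  come from the first of the three summands: in the other two, the large index would be an index
  of \<open>c\<close> itself.
\<close>
lemma eventually_cyclic_zero:
  fixes c :: "(gen \<times> gen \<times> gen) cvec"
  assumes 0: "\<And>m. let s = tensor_map (bracket (basis (L m))) id c in s + cyc s + cyc (cyc s) = 0"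
  shows "c = 0"
proof (rule poly_mapping_eqI)
  fix k :: "gen \<times> gen \<times> gen"
  obtain g1 g2 g3 where k: "k = (g1, g2, g3)" by (cases k)
  define K where "K = Max (insert 0 ((\<lambda>(h1, h2, h3). \<bar>index h2\<bar> + \<bar>index h3\<bar>) ` Poly_Mapping.keys c))"
  have K: "\<bar>index h2\<bar> + \<bar>index h3\<bar> \<le> K" if "Poly_Mapping.lookup c (h1, h2, h3) \<noteq> 0" for h1 h2 h3
    unfolding K_def using that by (intro Max_ge) (force simp: in_keys_iff)+
  have K0: "K \<ge> 0" unfolding K_def by (intro Max_ge) auto
  define m where "m = K + \<bar>index g1\<bar> + 1"
  define G where "G = shift m g1"
  have G: "\<bar>index G\<bar> > K" using K0 by (simp add: G_def m_def)
  define s where "s = tensor_map (bracket (basis (L m))) id c"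
  have z: "Poly_Mapping.lookup c (h1, G, h) = 0" "Poly_Mapping.lookup c (h1, h, G) = 0" for h1 h
    using K[of h1 G h] K[of h1 h G] G by linarith+
  have "Poly_Mapping.lookup (s + cyc s + cyc (cyc s)) (G, g2, g3) = 0"
    using 0[of m] by (simp add: s_def Let_def)
  then have "Poly_Mapping.lookup s (G, g2, g3) = 0"
    by (simp add: lookup_add lookup_cyc s_def lookup_L_first z)
  then have "of_int (index g1 + weight g1 * m) * Poly_Mapping.lookup c (g1, g2, g3) = 0"
    by (simp add: s_def lookup_L_first G_def del: of_int_add of_int_mult)
  moreover have "index g1 + weight g1 * m \<noteq> 0"
    using weight_cases[of g1] K0 by (auto simp: m_def)
  then have "(of_int (index g1 + weight g1 * m) :: complex) \<noteq> 0" by (rule of_int_nonzero)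
  ultimately show "Poly_Mapping.lookup c k = Poly_Mapping.lookup 0 k"
    by (simp add: k del: of_int_add of_int_mult)
qed

theorem theorem1p2:
  fixes \<Delta> :: "gen cvec \<Rightarrow> (gen \<times> gen) cvec"
  assumes "lie_bialgebra bracket \<Delta>"
  shows "\<exists>r. triangular_coboundary_lie_bialgebra bracket \<Delta> r"
proof -
  have co: "lie_coalgebra \<Delta>" and D: "tensor_derivation bracket \<Delta>"
    using assms by (auto simp: lie_bialgebra_def tensor_derivation_def lie_coalgebra_def)
  obtain r where r: "r \<in> skew_tensors" "\<And>x. \<Delta> x = adj_act bracket x r"
    using tensor_derivation_inner[OF D] co by (auto simp: lie_coalgebra_def)
  have skew: "twist r = - r" using r(1) by (simp add: skew_tensors_iff)
  have \<Delta>: "\<Delta> = (\<lambda>y. adj_act bracket y r)" using r(2) by blast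
  have "cyb bracket r = 0"
  proof (rule eventually_cyclic_zero)
    fix m
    show "let s = tensor_map (bracket (basis (L m))) id (cyb bracket r) in s + cyc s + cyc (cyc s) = 0"
      using co coJacobi_coboundary[OF lie_algebra_bracket skew, of "basis (L m)"]
      unfolding lie_coalgebra_def Let_def \<Delta> by metis
  qed
  then show ?thesis
    using assms r by (auto simp: triangular_coboundary_lie_bialgebra_def coboundary_lie_bialgebra_def)
qed

end
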